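(* It holds that $$2-\sqrt2\;\leq\; \pi_{\mathrm{cyc}}(K_3)\;\leq\;\frac35 .$$ More generally, for every integer $t\geq 3$, $$\pi_{\mathrm{cyc}}(K_t)\;\geq\; t-1-\sqrt{(t-2)^2+1}\;=\;1-\frac1{2(t-2)}+\frac1{8(t-2)^3}-O\left((t-2)^{-5}\right).$$ In particular, for every $t\geq 3$, for all sufficiently large $k$ and all $n$ sufficiently large in terms of $k$, there is a $K_t$-free subgraph of $C_n^k$ with average degree strictly larger than $\left(2-\frac1{t-2}\right)k+1$ (the minimum degree above which every subgraph of $C_n^k$ must contain $K_t$).
   Context: $C_n^k$ is the $k$th power of the cycle $C_n$ on $n$ vertices: two distinct vertices of $C_n$ are adjacent in $C_n^k$ if and only if their distance in $C_n$ is at most $k$. For graphs $F$ and $G$, the extremal number $\mathrm{ex}(G,F)$ is the maximum number of edges in an $F$-free subgraph of $G$, and $e(G)$ is the number of edges of $G$. The extremal density of $F$ in powers of cycles is $$\pi_{\mathrm{cyc}}(F)=\limsup_{k\to\infty}\limsup_{n\to\infty}\frac{\mathrm{ex}(C_n^k,F)}{e(C_n^k)}.$$ *)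

theory Defs
  imports "HOL-Library.Extended_Real" "HOL-Library.Landau_Symbols"
begin

datatype 'a graph = Graph (verts: "'a set") (edges: "'a set set")

definition simple_graph :: "'a graph \<Rightarrow> bool" where
  "simple_graph G \<longleftrightarrow> finite (verts G) \<and> (\<forall>e \<in> edges G. e \<subseteq> verts G \<and> card e = 2)"

definition subgraph :: "'a graph \<Rightarrow> 'a graph \<Rightarrow> bool" where
  "subgraph H G \<longleftrightarrow> simple_graph H \<and> verts H \<subseteq> verts G \<and> edges H \<subseteq> edges G"

text \<open>Containment is as a not necessarily induced subgraph.\<close>

definition contains_copy :: "'b graph \<Rightarrow> 'a graph \<Rightarrow> bool" where
  "contains_copy F G \<longleftrightarrow>
     (\<exists>f. inj_on f (verts F) \<and> f ` verts F \<subseteq> verts G \<and> (\<forall>e \<in> edges F. f ` e \<in> edges G))"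

abbreviation free_of :: "'b graph \<Rightarrow> 'a graph \<Rightarrow> bool" where
  "free_of F G \<equiv> \<not> contains_copy F G"

text \<open>For finite \<open>G\<close> and \<open>F\<close> with at least one vertex, the set below is finite and non-empty.\<close>

definition extremal_number :: "'a graph \<Rightarrow> 'b graph \<Rightarrow> nat" where
  "extremal_number G F = Max {card (edges H) | H. subgraph H G \<and> free_of F H}"

definition degree :: "'a graph \<Rightarrow> 'a \<Rightarrow> nat" where
  "degree G v = card {e \<in> edges G. v \<in> e}"

definition average_degree :: "'a graph \<Rightarrow> real" where
  "average_degree G = (\<Sum>v \<in> verts G. real (degree G v)) / real (card (verts G))"

text \<open>Only meaningful for graphs with at least one vertex.\<close>

definition minimum_degree :: "'a graph \<Rightarrow> nat" where
  "minimum_degree G = Min (degree G ` verts G)"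

definition walk :: "'a graph \<Rightarrow> 'a list \<Rightarrow> bool" where
  "walk G xs \<longleftrightarrow>
     xs \<noteq> [] \<and> set xs \<subseteq> verts G \<and> successively (\<lambda>u v. {u, v} \<in> edges G) xs"

text \<open>The distance is \<open>\<infinity>\<close> between vertices in different components.\<close>

definition graph_dist :: "'a graph \<Rightarrow> 'a \<Rightarrow> 'a \<Rightarrow> enat" where
  "graph_dist G u v =
     (INF xs \<in> {xs. walk G xs \<and> hd xs = u \<and> last xs = v}. enat (length xs - 1))"

definition graph_power :: "'a graph \<Rightarrow> nat \<Rightarrow> 'a graph" where
  "graph_power G k = Graph (verts G)
     {{u, v} | u v. u \<in> verts G \<and> v \<in> verts G \<and> u \<noteq> v \<and> graph_dist G u v \<le> enat k}"

definition complete_graph :: "nat \<Rightarrow> nat graph" where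
  "complete_graph t = Graph {..<t} {e. e \<subseteq> {..<t} \<and> card e = 2}"

text \<open>This is the cycle on \<open>n\<close> vertices for \<open>n \<ge> 3\<close>; smaller \<open>n\<close> are never relevant below,
  where \<open>n\<close> always tends to infinity.\<close>

definition cycle_graph :: "nat \<Rightarrow> nat graph" where
  "cycle_graph n = Graph {..<n} {{i, (i + 1) mod n} | i. i < n}"

abbreviation cycle_power :: "nat \<Rightarrow> nat \<Rightarrow> nat graph" where
  "cycle_power n k \<equiv> graph_power (cycle_graph n) k"

definition pi_cyc :: "'b graph \<Rightarrow> ereal" where
  "pi_cyc F = limsup (\<lambda>k. limsup (\<lambda>n.
     ereal (real (extremal_number (cycle_power n k) F) / real (card (edges (cycle_power n k))))))"

end

theory Submission
  imports Defs "HOL-Real_Asymp.Real_Asymp"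
begin

text \<open>
  \<^bold>\<open>Lower bound.\<close> With \<open>m = t - 2\<close>, cut the vertices into consecutive blocks of length about
  \<open>k / sqrt (m\<^sup>2 + 1)\<close>, colour the blocks cyclically with \<open>t - 1\<close> colours and keep the edges joining
  different colours. The missing edges lie within one block or join blocks \<open>t - 1\<close> apart, and this
  block length minimises their number.

  \<^bold>\<open>Upper bound.\<close> For a triangle-free subgraph let \<open>e d\<close> be the number of edges of length \<open>d\<close>. Five
  vertices span at most 6 edges, so averaging over all rotations of a five-point set \<open>q\<close> shows that
  the sum of \<open>e (q b - q a)\<close> over its ten pairs is at most \<open>6 n\<close>. There is a weighted system of
  five-point sets whose ten differences together cover \<open>{1..k}\<close> almost uniformly; summing the
  inequality over this system gives \<open>3 / 5 = 6 / 10\<close>.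

  \<^bold>\<open>Minimum degree.\<close> If every vertex misses at most \<open>s\<close> of the \<open>2 k\<close> vertices around it and
  \<open>m * (s + 1) < k\<close>, start from a shortest edge and repeatedly add the common neighbour nearest to the
  current clique on either side. All vertices skipped are missed by some member of the clique, and
  counting these misses keeps the clique short enough to be extended until it has \<open>m + 2\<close> vertices.
\<close>

section \<open>Powers of cycles\<close>

text \<open>A finite bound on an infimum in \<open>enat\<close> is reached by some walk: were all
  walks longer, every term would be at least \<open>Suc k\<close>.\<close>

lemma graph_dist_le_iff:
  "graph_dist G u v \<le> enat k \<longleftrightarrow>
    (\<exists>xs. walk G xs \<and> hd xs = u \<and> last xs = v \<and> length xs \<le> Suc k)" (is "?l \<longleftrightarrow> ?r")
proof
  assume ?l
  show ?r
  proof (rule ccontr)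
    assume n: "\<not> ?r"
    have le: "enat (Suc k) \<le> graph_dist G u v"
      unfolding graph_dist_def using n by (intro INF_greatest) force
    show False using order_trans[OF le \<open>?l\<close>] by simp
  qed
next
  assume ?r
  then obtain xs where xs: "walk G xs" "hd xs = u" "last xs = v" "length xs \<le> Suc k" by blast
  then have "graph_dist G u v \<le> enat (length xs - 1)"
    unfolding graph_dist_def by (intro INF_lower) simp
  also have "\<dots> \<le> enat k" using xs by simp
  finally show ?l .
qed

lemma cycle_graph_edge_shift:
  assumes "{u, v} \<in> edges (cycle_graph n)"
  obtains d :: int where "\<bar>d\<bar> \<le> 1" "int v mod int n = (int u + d) mod int n"
proof -
  obtain i where i: "i < n" "{u, v} = {i, (i + 1) mod n}"
    using assms by (auto simp: cycle_graph_def)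
  then consider "u = i" "v = (i + 1) mod n" | "v = i" "u = (i + 1) mod n"
    by (auto simp: doubleton_eq_iff)
  then show ?thesis
  proof cases
    case 1 then show ?thesis using that[of 1] by (simp add: zmod_int add.commute)
  next
    case 2 then show ?thesis using that[of "-1"] by (simp add: zmod_int mod_diff_left_eq)
  qed
qed

text \<open>Signed displacements in the integers treat both directions of travel at once; each edge
  adds at most one in absolute value.\<close>

lemma walk_cycle_graph_shift:
  assumes "walk (cycle_graph n) xs"
  shows "\<exists>d. \<bar>d\<bar> \<le> int (length xs) - 1 \<and> int (last xs) mod int n = (int (hd xs) + d) mod int n"
  using assms
proof (induction xs)
  case Nil
  then show ?case by (simp add: walk_def)
next
  case (Cons x xs)
  show ?case
  proof (cases xs)
    case Nil
    then show ?thesis by (intro exI[of _ 0]) simp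
  next
    case (Cons y ys)
    then have w: "walk (cycle_graph n) xs" and e: "{x, y} \<in> edges (cycle_graph n)"
      using Cons.prems by (auto simp: walk_def)
    obtain d where d: "\<bar>d\<bar> \<le> int (length xs) - 1" "int (last xs) mod int n = (int y + d) mod int n"
      using Cons.IH[OF w] Cons by auto
    obtain d' where d': "\<bar>d'\<bar> \<le> 1" "int y mod int n = (int x + d') mod int n"
      using cycle_graph_edge_shift[OF e] .
    have "int (last (x # xs)) mod int n = (int y + d) mod int n" using d Cons by simp
    also have "\<dots> = (int x + d' + d) mod int n" using d'(2) by (metis mod_add_left_eq)
    finally show ?thesis using d(1) d'(1) by (intro exI[of _ "d' + d"]) (auto simp: add.assoc)
  qed
qed

lemma graph_dist_cycle_shift_le:
  assumes "n > 0" "u < n"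
  shows "graph_dist (cycle_graph n) u ((u + d) mod n) \<le> enat d"
    and "graph_dist (cycle_graph n) ((u + d) mod n) u \<le> enat d"
proof -
  define xs where "xs = map (\<lambda>i. (u + i) mod n) [0..<Suc d]"
  have len: "length xs = Suc d" by (simp add: xs_def)
  have "{xs ! i, xs ! Suc i} \<in> edges (cycle_graph n)" if "i < d" for i
  proof -
    have "xs ! i = (u + i) mod n" "xs ! Suc i = ((u + i) mod n + 1) mod n"
      using that unfolding xs_def by (simp_all del: upt_Suc add: mod_Suc_eq)
    then show ?thesis using assms by (auto simp: cycle_graph_def)
  qed
  then have s: "successively (\<lambda>u v. {u, v} \<in> edges (cycle_graph n)) xs"
    by (simp add: successively_conv_nth len)
  have 1: "walk (cycle_graph n) xs"
    unfolding walk_def using s assms by (auto simp: xs_def cycle_graph_def)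
  have 2: "walk (cycle_graph n) (rev xs)"
    using 1 by (simp add: walk_def insert_commute)
  have hl: "hd xs = u" "last xs = (u + d) mod n"
    using assms by (simp_all add: xs_def hd_map del: upt_Suc) (simp add: last_map)
  show "graph_dist (cycle_graph n) u ((u + d) mod n) \<le> enat d"
    unfolding graph_dist_le_iff using 1 hl len by auto
  show "graph_dist (cycle_graph n) ((u + d) mod n) u \<le> enat d"
    unfolding graph_dist_le_iff using 2 hl len 
    by (intro exI[of _ "rev xs"]) (auto simp: hd_rev last_rev)
qed

text \<open>From here on adjacency is handled as a shift modulo \<open>n\<close>. The shift
  \<open>d = 0\<close> is excluded by \<open>u \<noteq> v\<close>.\<close>

lemma cycle_power_edge_iff:
  assumes "n > 0"
  shows "{u, v} \<in> edges (cycle_power n k) \<longleftrightarrow>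
    u < n \<and> v < n \<and> u \<noteq> v \<and> (\<exists>d\<le>k. v = (u + d) mod n \<or> u = (v + d) mod n)"
proof -
  have *: "graph_dist (cycle_graph n) u v \<le> enat k \<longleftrightarrow>
      (\<exists>d\<le>k. v = (u + d) mod n \<or> u = (v + d) mod n)" if uv: "u < n" "v < n" for u v
  proof
    assume "graph_dist (cycle_graph n) u v \<le> enat k"
    then obtain xs where xs: "walk (cycle_graph n) xs" "hd xs = u" "last xs = v" "length xs \<le> Suc k"
      unfolding graph_dist_le_iff by blast
    obtain d where d: "\<bar>d\<bar> \<le> int k" "int v mod int n = (int u + d) mod int n"
      using walk_cycle_graph_shift[OF xs(1)] xs by force
    show "\<exists>d\<le>k. v = (u + d) mod n \<or> u = (v + d) mod n"
    proof (cases "d \<ge> 0")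
      case True
      then have "int v = int ((u + nat d) mod n)" using d uv by (simp add: zmod_int)
      then show ?thesis using d True by (intro exI[of _ "nat d"]) auto
    next
      case False
      have "(int v - d) mod int n = (int u + d - d) mod int n"
        using d(2) by (metis mod_diff_left_eq)
      then have "int u = int ((v + nat (- d)) mod n)" using uv False by (simp add: zmod_int)
      then show ?thesis using d False by (intro exI[of _ "nat (-d)"]) auto
    qed
  next
    assume "\<exists>d\<le>k. v = (u + d) mod n \<or> u = (v + d) mod n"
    then obtain d where "d \<le> k" "v = (u + d) mod n \<or> u = (v + d) mod n" by blast
    then show "graph_dist (cycle_graph n) u v \<le> enat k"
      using graph_dist_cycle_shift_le[of n u d] graph_dist_cycle_shift_le[of n v d] assms uv
      by (auto intro: order_trans)
  qed
  have v: "verts (cycle_graph n) = {..<n}" by (simp add: cycle_graph_def)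
  show ?thesis
    unfolding graph_power_def v using *[of u v] *[of v u] by (auto simp: doubleton_eq_iff)
qed

lemma verts_cycle_power [simp]: "verts (cycle_power n k) = {..<n}"
  by (simp add: graph_power_def cycle_graph_def)

lemma edges_cycle_powerE:
  assumes "e \<in> edges (cycle_power n k)"
  obtains x d where "x < n" "1 \<le> d" "d \<le> k" "e = {x, (x + d) mod n}" "(x + d) mod n \<noteq> x"
proof -
  obtain u v where e: "e = {u, v}" using assms by (auto simp: graph_power_def)
  have "n > 0" using assms by (auto simp: graph_power_def cycle_graph_def)
  then have uv: "u < n \<and> v < n \<and> u \<noteq> v \<and> (\<exists>d\<le>k. v = (u + d) mod n \<or> u = (v + d) mod n)"
    using assms cycle_power_edge_iff e by blast
  then obtain d where d: "d \<le> k" "v = (u + d) mod n \<or> u = (v + d) mod n" by blast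
  have "d \<noteq> 0" using d uv by (intro notI) auto
  then have "1 \<le> d" by simp
  show ?thesis
  proof (cases "v = (u + d) mod n")
    case True
    then show ?thesis using that[of u d] uv \<open>1 \<le> d\<close> d(1) e by auto
  next
    case False
    then have "u = (v + d) mod n" using d by blast
    then show ?thesis using that[of v d] uv \<open>1 \<le> d\<close> d(1) e by (auto simp: insert_commute)
  qed
qed

lemma simple_graph_cycle_power: "simple_graph (cycle_power n k)"
  by (auto simp: simple_graph_def graph_power_def cycle_graph_def card_2_iff)

text \<open>Under \<open>2 * k < n\<close> an edge determines its starting point and its length:
  read from the other end it would have length \<open>n - d > k\<close>.\<close>

lemma card_edges_cycle_power:
  assumes "2 * k < n"
  shows "card (edges (cycle_power n k)) = n * k"
proof -
  let ?f = "\<lambda>(x, d). {x, (x + d) mod n}"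
  have inj: "inj_on ?f ({..<n} \<times> {1..k})"
  proof (rule inj_onI)
    fix p q assume pq: "p \<in> {..<n} \<times> {1..k}" "q \<in> {..<n} \<times> {1..k}" "?f p = ?f q"
    obtain x d y c where p: "p = (x, d)" "q = (y, c)" by (cases p, cases q)
    have A: "x \<in> {..<n}" "d \<in> {1..k}" "y \<in> {..<n}" "c \<in> {1..k}"
      and eq: "{x, (x + d) mod n} = {y, (y + c) mod n}"
      using pq p by auto
    have m: "(z + b) mod n = (if z + b < n then z + b else z + b - n)" if "z < n" "b \<le> k" for z b
      using that assms by (simp add: mod_if)
    show "p = q"
      using eq A assms p by (auto simp: m doubleton_eq_iff split: if_splits)
  qed
  have "edges (cycle_power n k) = ?f ` ({..<n} \<times> {1..k})"
  proof
    show "edges (cycle_power n k) \<subseteq> ?f ` ({..<n} \<times> {1..k})"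
    proof
      fix e assume "e \<in> edges (cycle_power n k)"
      then obtain x d where "x < n" "1 \<le> d" "d \<le> k" "e = {x, (x + d) mod n}"
        by (rule edges_cycle_powerE)
      then show "e \<in> ?f ` ({..<n} \<times> {1..k})" by (intro image_eqI[of _ _ "(x, d)"]) auto
    qed
    show "?f ` ({..<n} \<times> {1..k}) \<subseteq> edges (cycle_power n k)"
    proof (rule image_subsetI)
      fix p assume "p \<in> {..<n} \<times> {1..k}"
      then obtain x d where p: "p = (x, d)" and A: "x \<in> {..<n}" "d \<in> {1..k}" by blast
      then have "(x + d) mod n \<noteq> x" using assms by (auto simp: mod_if)
      then have "{x, (x + d) mod n} \<in> edges (cycle_power n k)"
        using A assms by (subst cycle_power_edge_iff) auto
      then show "?f p \<in> edges (cycle_power n k)" by (simp add: p)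
    qed
  qed
  then show ?thesis using card_image[OF inj] by simp
qed

section \<open>Subgraphs and copies of complete graphs\<close>

lemma finite_edges_subgraph: "subgraph H G \<Longrightarrow> finite (edges H)"
  unfolding subgraph_def simple_graph_def
  by (meson PowI finite_Pow_iff finite_subset subsetI)

text \<open>Adjacent vertices of a simple graph differ, so \<open>g\<close> is automatically
  injective on \<open>A\<close>. This lets \<open>g\<close> be the reduction of integers modulo
  \<open>n\<close>.\<close>

lemma contains_complete_graphI:
  assumes H: "simple_graph H" and A: "finite A" "card A = t" "g ` A \<subseteq> verts H"
    and edge: "\<And>x y. x \<in> A \<Longrightarrow> y \<in> A \<Longrightarrow> x \<noteq> y \<Longrightarrow> {g x, g y} \<in> edges H"
  shows "contains_copy (complete_graph t) H"
proof -
  obtain f where f: "bij_betw f {..<t} A"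
    using ex_bij_betw_nat_finite[OF A(1)] A(2) by (auto simp: lessThan_atLeast0)
  have ne: "g x \<noteq> g y" if "x \<in> A" "y \<in> A" "x \<noteq> y" for x y
  proof -
    have "card {g x, g y} = 2" using edge[OF that] H unfolding simple_graph_def by blast
    then show ?thesis by auto
  qed
  have "(g \<circ> f) ` e \<in> edges H" if "e \<in> edges (complete_graph t)" for e
  proof -
    have e: "e \<subseteq> {..<t}" "card e = 2" using that by (auto simp: complete_graph_def)
    then obtain i j where ij: "e = {i, j}" "i \<noteq> j" by (auto simp: card_2_iff)
    then have "f i \<in> A" "f j \<in> A" "f i \<noteq> f j"
      using e f by (auto simp: bij_betw_def inj_on_def)
    then show ?thesis using edge ij by simp
  qed
  moreover have "inj_on (g \<circ> f) {..<t}"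
    using f ne unfolding bij_betw_def inj_on_def by force
  moreover have "(g \<circ> f) ` {..<t} \<subseteq> verts H"
    using f A(3) by (auto simp: bij_betw_def)
  ultimately show ?thesis
    unfolding contains_copy_def by (intro exI[of _ "g \<circ> f"]) (auto simp: complete_graph_def)
qed

lemma contains_triangleI:
  assumes "{x, y} \<in> edges H" "{y, z} \<in> edges H" "{x, z} \<in> edges H" and H: "simple_graph H"
  shows "contains_copy (complete_graph 3) H"
proof (rule contains_complete_graphI[OF H, of "{x, y, z}" _ id])
  have "card {x, y} = 2" "card {y, z} = 2" "card {x, z} = 2"
    using assms unfolding simple_graph_def by blast+
  then show "card {x, y, z} = 3" by (auto simp: card_insert_if split: if_splits)
  show "id ` {x, y, z} \<subseteq> verts H" using assms unfolding simple_graph_def by auto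
  show "{id u, id v} \<in> edges H" if "u \<in> {x, y, z}" "v \<in> {x, y, z}" "u \<noteq> v" for u v
    using that assms(1-3) by (auto simp: insert_commute)
qed simp

section \<open>Triangle-free subgraphs\<close>

lemma sum_periodic_shift:
  fixes f :: "int \<Rightarrow> 'a::comm_monoid_add"
  assumes "n > 0" and "\<And>x. f (x mod n) = f x"
  shows "(\<Sum>x\<in>{0..<n}. f (x + q)) = (\<Sum>x\<in>{0..<n}. f x)"
proof (rule sum.reindex_bij_witness[of _ "\<lambda>x. (x - q) mod n" "\<lambda>x. (x + q) mod n"])
  fix x assume x: "x \<in> {0..<n}"
  show "((x + q) mod n - q) mod n = x" "((x - q) mod n + q) mod n = x"
    using x by (simp_all add: mod_diff_left_eq mod_add_left_eq)
  show "(x + q) mod n \<in> {0..<n}" "(x - q) mod n \<in> {0..<n}"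
    using assms(1) by simp_all
  show "f ((x + q) mod n) = f (x + q)" by (rule assms(2))
qed

text \<open>Mantel's bound \<open>25 / 4\<close>, rounded down, obtained from the ten triples. Pairs
  of indices are counted, so points may coincide, as happens when a set wraps around the
  cycle.\<close>

lemma triangle_free_five_points:
  fixes E :: "'v \<Rightarrow> 'v \<Rightarrow> bool" and q :: "nat \<Rightarrow> 'v"
  assumes "\<And>x y z. \<not> (E x y \<and> E y z \<and> E x z)"
  shows "(\<Sum>b<5. \<Sum>a<b. of_bool (E (q a) (q b)) :: real) \<le> 6"
proof -
  have T: "\<not> E (q a) (q b) \<or> \<not> E (q b) (q c) \<or> \<not> E (q a) (q c)" for a b c
    using assms by blast
  show ?thesis
    using T[of 0 1 2] T[of 0 1 3] T[of 0 1 4] T[of 0 2 3] T[of 0 2 4] T[of 0 3 4]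
      T[of 1 2 3] T[of 1 2 4] T[of 1 3 4] T[of 2 3 4]
    by (simp add: eval_nat_numeral lessThan_Suc of_bool_def) argo
qed

text \<open>For each \<open>i\<close> the points \<open>D + l * s + c i\<close> form a comb of
  spacing \<open>l\<close>. Every residue class modulo \<open>l\<close> is met by exactly
  \<open>\<kappa>\<close> combs, so a point far enough from the ends is a tooth of
  \<open>\<kappa>\<close> of them; the remaining teeth only enlarge the right-hand side. Trimming
  \<open>w + l\<close> at both ends forces \<open>0 < s < N\<close>.\<close>

lemma comb_sum_ge:
  fixes e :: "int \<Rightarrow> real" and c :: "nat \<Rightarrow> int"
  assumes e: "\<And>y. e y \<ge> 0" and l: "l > 0"
    and c: "\<And>i. i < m \<Longrightarrow> \<bar>c i\<bar> \<le> w"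
    and eqd: "\<And>r. card {i\<in>{..<m}. (r - c i) mod l = 0} = \<kappa>"
  shows "real \<kappa> * (\<Sum>y\<in>{D + w + l<..<D + l * int N - w - l}. e y)
     \<le> (\<Sum>i<m. \<Sum>s<N. e (D + l * int s + c i))"
proof -
  let ?I = "{D + w + l<..<D + l * int N - w - l}"
  have "real \<kappa> * (\<Sum>y\<in>?I. e y) = (\<Sum>y\<in>?I. \<Sum>i<m. of_bool ((y - D - c i) mod l = 0) * e y)"
  proof -
    have *: "(\<Sum>i<m. of_bool ((y - D - c i) mod l = 0) * e y) = real \<kappa> * e y" for y
    proof -
      have "(\<Sum>i<m. of_bool ((y - D - c i) mod l = 0) * e y)
          = real (card {i\<in>{..<m}. (y - D - c i) mod l = 0}) * e y"
        by (simp add: of_bool_def sum_distrib_right[symmetric] sum.If_cases Int_def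
             del: mod_0_imp_dvd mod_eq_0_iff_dvd)
      then show ?thesis using eqd[of "y - D"] by simp
    qed
    show ?thesis unfolding * sum_distrib_left ..
  qed
  also have "\<dots> = (\<Sum>i<m. \<Sum>y\<in>?I. of_bool ((y - D - c i) mod l = 0) * e y)"
    by (rule sum.swap)
  also have "\<dots> \<le> (\<Sum>i<m. \<Sum>s<N. e (D + l * int s + c i))"
  proof (rule sum_mono)
    fix i assume i: "i \<in> {..<m}"
    let ?J = "{y\<in>?I. (y - D - c i) mod l = 0}" and ?g = "\<lambda>s. D + l * int s + c i"
    have inj: "inj_on ?g {..<N}" using l by (auto simp: inj_on_def)
    have "(\<Sum>y\<in>?I. of_bool ((y - D - c i) mod l = 0) * e y) = (\<Sum>y\<in>?J. e y)"
      by (rule sum.mono_neutral_cong_right) auto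
    also have "\<dots> \<le> (\<Sum>y\<in>?g ` {..<N}. e y)"
    proof (rule sum_mono2)
      show "?J \<subseteq> ?g ` {..<N}"
      proof
        fix y assume y: "y \<in> ?J"
        then obtain s where s: "y - D - c i = l * s" by auto
        have ci: "\<bar>c i\<bar> \<le> w" using c i by simp
        have "D + w + l < y" "y < D + l * int N - w - l" using y by auto
        then have "l * s > 0" and "l * s < l * int N" using s ci l by linarith+
        then have "0 < s" "s < int N" using l by (simp_all add: zero_less_mult_iff mult_less_cancel_left_pos)
        then show "y \<in> ?g ` {..<N}" using s by (intro image_eqI[of _ _ "nat s"]) auto
      qed
    qed (use e in auto)
    also have "\<dots> = (\<Sum>s<N. e (?g s))" using sum.reindex[OF inj] by simp
    finally show "(\<Sum>y\<in>?I. of_bool ((y - D - c i) mod l = 0) * e y) \<le> (\<Sum>s<N. e (?g s))" .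
  qed
  finally show ?thesis .
qed

text \<open>A five-point family consists of the points \<open>N * P l + l * s + jitter l i\<close> for slopes
  \<open>l = 0, \<dots>, 4\<close>, with parameters \<open>s < N\<close> and \<open>i < 12\<close>. For \<open>a < b\<close>, the difference of the points
  with slopes \<open>a\<close> and \<open>b\<close> moves in steps of \<open>b - a\<close> as \<open>s\<close> varies; the jitter makes it
  equidistributed modulo \<open>b - a\<close>, so that no residue class is missed.\<close>

definition jitter :: "nat \<Rightarrow> nat \<Rightarrow> int" where
  "jitter l i = (if l < 2 then int i else if l = 2 then int (i div 2 mod 2) else 0)"

lemma sum_less_12:
  fixes g :: "nat \<Rightarrow> nat"
  shows "(\<Sum>i<12. g i) = g 0 + g 1 + g 2 + g 3 + g 4 + g 5 + g 6 + g 7 + g 8 + g 9 + g 10 + g 11"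
  by (simp add: eval_nat_numeral lessThan_Suc)

text \<open>\<open>12\<close> is divisible by all steps \<open>1, 2, 3, 4\<close>. Slope
  \<open>2\<close> moves by the second binary digit of \<open>i\<close> because it lies at even
  distance from slopes \<open>0\<close> and \<open>4\<close>: both this digit and its difference
  from \<open>i\<close> are balanced modulo \<open>2\<close>.\<close>

lemma jitter_equidistributed:
  assumes "a < b" "b < 5"
  shows "card {i\<in>{..<12}. (r - (jitter b i - jitter a i)) mod (int b - int a) = 0} = 12 div (b - a)"
proof -
  have A: "card {i\<in>{..<12}. (r - (jitter b i - jitter a i)) mod l = 0}
      = (\<Sum>i<12. of_bool (((r mod l) - (jitter b i - jitter a i)) mod l = 0))" for l :: int
    by (simp add: mod_diff_left_eq of_bool_def sum.If_cases Int_def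
         del: mod_0_imp_dvd mod_eq_0_iff_dvd)
  consider "b = a + 1" | "b = a + 2" | "b = a + 3" | "b = a + 4" using assms by linarith
  then show ?thesis
  proof cases
    case 1
    then show ?thesis by simp
  next
    case 2
    have "r mod 2 = 0 \<or> r mod 2 = 1" by presburger
    moreover have "a = 0 \<or> a = 1 \<or> a = 2" using assms 2 by auto
    ultimately show ?thesis unfolding A sum_less_12 unfolding 2 diff_add_inverse
      by (elim disjE) (simp_all add: jitter_def del: mod_0_imp_dvd mod_eq_0_iff_dvd)
  next
    case 3
    have "r mod 3 = 0 \<or> r mod 3 = 1 \<or> r mod 3 = 2" by presburger
    moreover have "a = 0 \<or> a = 1" using assms 3 by auto
    ultimately show ?thesis unfolding A sum_less_12 unfolding 3 diff_add_inverse
      by (elim disjE) (simp_all add: jitter_def del: mod_0_imp_dvd mod_eq_0_iff_dvd)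
  next
    case 4
    have "r mod 4 = 0 \<or> r mod 4 = 1 \<or> r mod 4 = 2 \<or> r mod 4 = 3" by presburger
    moreover have "a = 0" using assms 4 by auto
    ultimately show ?thesis unfolding A sum_less_12 unfolding 4 diff_add_inverse
      by (elim disjE) (simp_all add: jitter_def del: mod_0_imp_dvd mod_eq_0_iff_dvd)
  qed
qed

text \<open>The margin \<open>15\<close> absorbs the jitter (at most \<open>11\<close>) and one step (at most \<open>4\<close>).\<close>

definition cell_sum :: "(int \<Rightarrow> real) \<Rightarrow> nat \<Rightarrow> int \<Rightarrow> real" where
  "cell_sum e N c = (\<Sum>y\<in>{c * int N + 15<..<(c + 1) * int N - 15}. e y)"

text \<open>With equal open margins, negation carries the cell \<open>c\<close> exactly onto the
  cell \<open>- c - 1\<close>, so negative differences can be folded back.\<close>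

lemma cell_sum_reflect:
  assumes "\<And>y. e (- y) = e y"
  shows "cell_sum e N (- c - 1) = cell_sum e N c"
  unfolding cell_sum_def
  by (rule sum.reindex_bij_witness[of _ uminus uminus]) (auto simp: algebra_simps assms)

lemma cells_disjoint:
  fixes c c' :: int
  assumes "c \<noteq> c'"
  shows "{c * int N + 15<..<(c + 1) * int N - 15} \<inter> {c' * int N + 15<..<(c' + 1) * int N - 15} = {}"
proof -
  have "(c + 1) * int N \<le> c' * int N" if "c < c'" for c c' :: int
    using that by (intro mult_right_mono) auto
  then have "(c + 1) * int N \<le> c' * int N \<or> (c' + 1) * int N \<le> c * int N"
    using assms by (meson linorder_neqE)
  then show ?thesis by auto
qed

lemma sum_cell_sum:
  fixes C :: "int set"
  assumes "finite C"
  shows "(\<Sum>c\<in>C. cell_sum e N c)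
    = sum e (\<Union>c\<in>C. {c * int N + 15<..<(c + 1) * int N - 15})"
  unfolding cell_sum_def using assms cells_disjoint
  by (intro sum.UNION_disjoint[symmetric]) auto

text \<open>As \<open>s\<close> runs below \<open>N\<close>, the difference advances in steps of
  \<open>b - a\<close> and sweeps the \<open>b - a\<close> cells from \<open>P b - P a\<close> on.
  Over the twelve jitters each point away from the margins is hit \<open>12 div (b - a)\<close>
  times.\<close>

lemma pair_sum_ge:
  assumes e: "\<And>y. e y \<ge> 0" and ab: "a < b" "b < 5"
  shows "real (12 div (b - a)) * (\<Sum>j<b - a. cell_sum e N (P b - P a + int j))
    \<le> (\<Sum>i<12. \<Sum>s<N. e ((int N * P b + int b * int s + jitter b i)
                          - (int N * P a + int a * int s + jitter a i)))"
proof -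
  define l D where "l = int b - int a" and "D = P b - P a"
  have l: "0 < l" "l \<le> 4" using ab by (auto simp: l_def)
  have "(\<Sum>j<b - a. cell_sum e N (D + int j)) = (\<Sum>c\<in>{D..<D + l}. cell_sum e N c)"
    by (rule sum.reindex_bij_witness[of _ "\<lambda>c. nat (c - D)" "\<lambda>j. D + int j"])
      (use ab in \<open>auto simp: l_def\<close>)
  also have "\<dots> = sum e (\<Union>c\<in>{D..<D + l}. {c * int N + 15<..<(c + 1) * int N - 15})"
    by (rule sum_cell_sum) simp
  also have "\<dots> \<le> sum e {D * int N + 11 + l<..<D * int N + l * int N - 11 - l}"
  proof (rule sum_mono2)
    show "(\<Union>c\<in>{D..<D + l}. {c * int N + 15<..<(c + 1) * int N - 15})
      \<subseteq> {D * int N + 11 + l<..<D * int N + l * int N - 11 - l}"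
    proof
      fix y assume "y \<in> (\<Union>c\<in>{D..<D + l}. {c * int N + 15<..<(c + 1) * int N - 15})"
      then obtain c where c: "D \<le> c" "c + 1 \<le> D + l" "c * int N + 15 < y" "y < (c + 1) * int N - 15"
        by auto
      have "D * int N \<le> c * int N" "(c + 1) * int N \<le> (D + l) * int N"
        using c by (intro mult_right_mono; simp)+
      then have "D * int N + 11 + l < y" "y < D * int N + l * int N - 11 - l"
        using c l unfolding distrib_right by linarith+
      then show "y \<in> {D * int N + 11 + l<..<D * int N + l * int N - 11 - l}" by simp
    qed
  qed (use e in auto)
  finally have "real (12 div (b - a)) * (\<Sum>j<b - a. cell_sum e N (D + int j))
    \<le> real (12 div (b - a)) * sum e {D * int N + 11 + l<..<D * int N + l * int N - 11 - l}"
    by (intro mult_left_mono) auto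
  also have "\<dots> \<le> (\<Sum>i<12. \<Sum>s<N. e (D * int N + l * int s + (jitter b i - jitter a i)))"
  proof (rule comb_sum_ge[OF e l(1)])
    fix i :: nat assume "i < 12"
    have "0 \<le> jitter b i" "jitter b i \<le> 11" "0 \<le> jitter a i" "jitter a i \<le> 11"
      using \<open>i < 12\<close> by (auto simp: jitter_def)
    then show "\<bar>jitter b i - jitter a i\<bar> \<le> 11" by linarith
  next
    show "card {i\<in>{..<12}. (r - (jitter b i - jitter a i)) mod l = 0} = 12 div (b - a)" for r
      unfolding l_def using jitter_equidistributed[OF ab] .
  qed
  also have "\<dots> = (\<Sum>i<12. \<Sum>s<N. e ((int N * P b + int b * int s + jitter b i)
                          - (int N * P a + int a * int s + jitter a i)))"
    by (intro sum.cong refl arg_cong[of _ _ e]) (simp add: D_def l_def algebra_simps)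
  finally show ?thesis by (simp add: D_def)
qed

lemma family_sum_le:
  assumes e: "\<And>y. e y \<ge> 0"
    and five: "\<And>q :: nat \<Rightarrow> int. (\<Sum>b<5. \<Sum>a<b. e (q b - q a)) \<le> B"
  shows "(\<Sum>b<5. \<Sum>a<b. real (12 div (b - a)) * (\<Sum>j<b - a. cell_sum e N (P b - P a + int j)))
    \<le> 12 * real N * B"
proof -
  let ?q = "\<lambda>i s b. int N * P b + int b * int s + jitter b i"
  have "(\<Sum>b<5. \<Sum>a<b. real (12 div (b - a)) * (\<Sum>j<b - a. cell_sum e N (P b - P a + int j)))
    \<le> (\<Sum>b<5. \<Sum>a<b. \<Sum>i<12. \<Sum>s<N. e (?q i s b - ?q i s a))"
    by (intro sum_mono pair_sum_ge e) auto
  also have "\<dots> = (\<Sum>i<12. \<Sum>s<N. \<Sum>b<5. \<Sum>a<b. e (?q i s b - ?q i s a))"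
    (is "?l = ?r")
  proof -
    \<comment> \<open>The range of \<open>a\<close> depends on \<open>b\<close>, so the pairs are
      flattened into one index set before the sums are exchanged.\<close>
    let ?Q = "Sigma {..<5} lessThan"
    have "?l = (\<Sum>(b,a)\<in>?Q. \<Sum>i<12. \<Sum>s<N. e (?q i s b - ?q i s a))"
      by (rule sum.Sigma) auto
    also have "\<dots> = (\<Sum>i<12. \<Sum>(b,a)\<in>?Q. \<Sum>s<N. e (?q i s b - ?q i s a))"
      unfolding split_def by (rule sum.swap)
    also have "\<dots> = (\<Sum>i<12. \<Sum>s<N. \<Sum>(b,a)\<in>?Q. e (?q i s b - ?q i s a))"
      unfolding split_def by (intro sum.cong refl sum.swap)
    also have "\<dots> = ?r"
      by (intro sum.cong refl sum.Sigma[symmetric]) auto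
    finally show ?thesis .
  qed
  also have "\<dots> \<le> (\<Sum>i<12::nat. \<Sum>s<N. B)"
    by (intro sum_mono five)
  finally show ?thesis by simp
qed

lemma sum_pairs_less_5:
  fixes g :: "nat \<Rightarrow> nat \<Rightarrow> real"
  shows "(\<Sum>b<5. \<Sum>a<b. g a b)
    = g 0 1 + g 0 2 + g 1 2 + g 0 3 + g 1 3 + g 2 3 + g 0 4 + g 1 4 + g 2 4 + g 3 4"
  by (simp add: eval_nat_numeral lessThan_Suc)

text \<open>Each of the ten pairs covers \<open>12\<close> cells with multiplicity, so a family
  covers \<open>120\<close>. Spreading them evenly over seven cells turns the bound
  \<open>12 * N * B\<close> into \<open>12 * 7 / 120 = 7 / 10\<close> times
  \<open>N * B\<close>.\<close>

lemma total_cell_sum_le: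
  assumes e: "\<And>y. e y \<ge> 0" and sym: "\<And>y. e (- y) = e y"
    and five: "\<And>q :: nat \<Rightarrow> int. (\<Sum>b<5. \<Sum>a<b. e (q b - q a)) \<le> B"
  shows "(\<Sum>c<7. cell_sum e N (int c)) \<le> 7 / 10 * real N * B"
proof -
  define S where "S = cell_sum e N"
  define F where "F = (\<lambda>P. \<Sum>b<5. \<Sum>a<b. real (12 div (b - a)) *
    (\<Sum>j<b - a. S (P ! b - P ! a + int j)))"
  have neg: "S (-1) = S 0" "S (-2) = S 1" "S (-3) = S 2" "S (-4) = S 3" "S (-5) = S 4"
    "S (-6) = S 5" "S (-7) = S 6"
    using cell_sum_reflect[of e N 0] cell_sum_reflect[of e N 1] cell_sum_reflect[of e N 2]
      cell_sum_reflect[of e N 3] cell_sum_reflect[of e N 4] cell_sum_reflect[of e N 5]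
      cell_sum_reflect[of e N 6] sym
    by (simp_all add: S_def)
  have F: "F P \<le> 12 * real N * B" for P
    unfolding F_def S_def by (intro family_sum_le e five)
  \<comment> \<open>These six families with the weights 129, 1247, 165, 53, 241 and 223 (total 2058) solve the
    linear program asking that every cell be covered equally often, namely 35280 times. They were
    found by computer; \<open>F P\<close> lists the point of slope \<open>l\<close> at position \<open>l\<close> of \<open>P\<close>, and a negative
    difference is read as its absolute value.\<close>
  have F0: "F [6,0,6,0,1] = 12 * S 0 + 31 * S 1 + 7 * S 2 + 17 * S 3 + 13 * S 4 + 28 * S 5 + 12 * S 6"
    unfolding F_def sum_pairs_less_5
    by (simp add: lessThan_nat_numeral lessThan_Suc neg)
  have F1: "F [4,6,7,0,0] = 15 * S 0 + 19 * S 1 + 19 * S 2 + 17 * S 3 + 16 * S 4 + 16 * S 5 + 18 * S 6"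
    unfolding F_def sum_pairs_less_5
    by (simp add: lessThan_nat_numeral lessThan_Suc neg)
  have F2: "F [6,0,6,0,2] = 15 * S 0 + 15 * S 1 + 25 * S 2 + 17 * S 3 + 8 * S 4 + 28 * S 5 + 12 * S 6"
    unfolding F_def sum_pairs_less_5
    by (simp add: lessThan_nat_numeral lessThan_Suc neg)
  have F3: "F [3,7,0,0,4] = 20 * S 0 + 17 * S 1 + 17 * S 2 + 3 * S 3 + 33 * S 4 + 12 * S 5 + 18 * S 6"
    unfolding F_def sum_pairs_less_5
    by (simp add: lessThan_nat_numeral lessThan_Suc neg)
  have F4: "F [4,7,0,0,4] = 19 * S 0 + 11 * S 1 + 17 * S 2 + 25 * S 3 + 18 * S 4 + 12 * S 5 + 18 * S 6"
    unfolding F_def sum_pairs_less_5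
    by (simp add: lessThan_nat_numeral lessThan_Suc neg)
  have F5: "F [0,6,5,0,0] = 31 * S 0 + 7 * S 1 + 7 * S 2 + 13 * S 3 + 28 * S 4 + 16 * S 5 + 18 * S 6"
    unfolding F_def sum_pairs_less_5
    by (simp add: lessThan_nat_numeral lessThan_Suc neg)
  show ?thesis
    using F[of "[6,0,6,0,1]"] F[of "[4,6,7,0,0]"] F[of "[6,0,6,0,2]"] F[of "[3,7,0,0,4]"]
      F[of "[4,7,0,0,4]"] F[of "[0,6,5,0,0]"]
    unfolding F0 F1 F2 F3 F4 F5
    by (simp add: S_def[symmetric] lessThan_nat_numeral lessThan_Suc)
qed

text \<open>The cells fill \<open>{1..k}\<close> except for at most \<open>31\<close> points per
  cell lost to the margins and at most \<open>6\<close> left over by \<open>k div 7\<close>. These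
  \<open>7 * 31 + 6 = 223\<close> values are bounded by \<open>M\<close> each.\<close>

lemma window_sum_le:
  assumes e: "\<And>y. e y \<ge> 0" and sym: "\<And>y. e (- y) = e y"
    and five: "\<And>q :: nat \<Rightarrow> int. (\<Sum>b<5. \<Sum>a<b. e (q b - q a)) \<le> B"
    and M: "\<And>y. e y \<le> M"
  shows "(\<Sum>d=1..k. e (int d)) \<le> 7 / 10 * real (k div 7) * B + 223 * M"
proof -
  define N where "N = k div 7"
  define U where "U = (\<Union>c\<in>{0..<7}. {c * int N + 15<..<(c + 1) * int N - 15})"
  \<comment> \<open>Used twice: \<open>e\<close> gives the main part, the constant \<open>1\<close>
    counts \<open>U\<close>.\<close>
  have cells: "(\<Sum>c<7. cell_sum f N (int c)) = sum f U" for f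
  proof -
    have "(\<Sum>c<7. cell_sum f N (int c)) = (\<Sum>c\<in>{0..<7}. cell_sum f N c)"
      by (rule sum.reindex_bij_witness[of _ nat int]) auto
    then show ?thesis unfolding U_def by (simp add: sum_cell_sum)
  qed
  have U: "U \<subseteq> {1..int k}"
  proof
    fix y assume "y \<in> U"
    then obtain c where c: "0 \<le> c" "c + 1 \<le> 7" "c * int N + 15 < y" "y < (c + 1) * int N - 15"
      by (auto simp: U_def)
    have "0 \<le> c * int N" using c by simp
    moreover have "(c + 1) * int N \<le> 7 * int N" using c(2) by (intro mult_right_mono) auto
    moreover have "7 * int N \<le> int k" unfolding N_def by simp
    ultimately have "1 \<le> y \<and> y \<le> int k" using c(3,4) by linarith
    then show "y \<in> {1..int k}" by simp
  qed
  then have finU: "finite U" using finite_subset by blast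
  have "7 * (real N - 31) \<le> (\<Sum>c<7. cell_sum (\<lambda>_. 1) N (int c))"
  proof -
    have "real N - 31 \<le> cell_sum (\<lambda>_. 1) N c" for c
      by (simp add: cell_sum_def algebra_simps)
    then have "(\<Sum>c<7::nat. real N - 31) \<le> (\<Sum>c<7. cell_sum (\<lambda>_. 1) N (int c))"
      by (intro sum_mono)
    then show ?thesis by simp
  qed
  also have "\<dots> = real (card U)" by (simp add: cells)
  finally have cardU: "7 * (real N - 31) \<le> real (card U)" .
  have "real (card ({1..int k} - U)) = real k - real (card U)"
    using U finU card_mono[OF _ U] by (simp add: card_Diff_subset of_nat_diff)
  moreover have "real k \<le> 7 * real N + 6" unfolding N_def by linarith
  ultimately have rest: "real (card ({1..int k} - U)) \<le> 223" using cardU by argo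
  have "(\<Sum>d=1..k. e (int d)) = sum e {1..int k}"
    by (rule sum.reindex_bij_witness[of _ nat int]) auto
  also have "\<dots> = sum e U + sum e ({1..int k} - U)"
    using sum.subset_diff[OF U, of e] by simp
  also have "sum e ({1..int k} - U) \<le> real (card ({1..int k} - U)) * M"
    using M by (intro sum_bounded_above)
  also have "\<dots> \<le> 223 * M"
    using rest e[of 0] M[of 0] by (intro mult_right_mono) auto
  also have "sum e U \<le> 7 / 10 * real N * B"
    using total_cell_sum_le[of e B N, OF e sym five] by (simp add: cells)
  finally show ?thesis by (simp add: N_def)
qed

text \<open>All integers \<open>d\<close> are allowed, so that differences of arbitrary integer
  points can be inserted.\<close>

definition shift_edges :: "nat graph \<Rightarrow> nat \<Rightarrow> int \<Rightarrow> real" where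
  "shift_edges H n d =
    (\<Sum>x\<in>{0..<int n}. of_bool ({nat (x mod int n), nat ((x + d) mod int n)} \<in> edges H))"

text \<open>Rotating \<open>x\<close> by \<open>- a\<close> leaves only the difference of the two
  offsets. Averaging over rotations of a five-point set thus becomes an inequality for
  \<open>shift_edges\<close>.\<close>

lemma shift_edges_translate:
  assumes "n > 0"
  shows "(\<Sum>x\<in>{0..<int n}.
      of_bool ({nat ((x + a) mod int n), nat ((x + b) mod int n)} \<in> edges H)) = shift_edges H n (b - a)"
proof -
  let ?f = "\<lambda>x. of_bool ({nat (x mod int n), nat ((x + (b - a)) mod int n)} \<in> edges H) :: real"
  have "?f (x mod int n) = ?f x" for x by (simp only: mod_add_left_eq mod_mod_trivial)
  then have "(\<Sum>x\<in>{0..<int n}. ?f (x + a)) = (\<Sum>x\<in>{0..<int n}. ?f x)"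
    using assms by (intro sum_periodic_shift) auto
  then show ?thesis unfolding shift_edges_def by (simp only: add.assoc add_diff_cancel_left' diff_add_cancel add.commute[of a])
qed

lemma shift_edges_minus:
  assumes "n > 0"
  shows "shift_edges H n (- d) = shift_edges H n d"
  using shift_edges_translate[OF assms, of d 0 H]
  by (simp add: shift_edges_def insert_commute)

text \<open>Only an inequality, since for small \<open>n\<close> one edge may arise from several
  lengths or from both of its ends.\<close>

lemma card_edges_le_shift_edges:
  assumes H: "subgraph H (cycle_power n k)"
  shows "real (card (edges H)) \<le> (\<Sum>d=1..k. shift_edges H n (int d))"
proof -
  let ?A = "\<lambda>d. {x\<in>{0..<int n}. {nat (x mod int n), nat ((x + int d) mod int n)} \<in> edges H}"
  let ?f = "\<lambda>(d, x). {nat (x mod int n), nat ((x + int d) mod int n)}"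
  have sub: "edges H \<subseteq> ?f ` Sigma {1..k} ?A"
  proof
    fix e assume e: "e \<in> edges H"
    then have "e \<in> edges (cycle_power n k)" using H by (auto simp: subgraph_def)
    then obtain x d where x: "x < n" "1 \<le> d" "d \<le> k" "e = {x, (x + d) mod n}"
      by (rule edges_cycle_powerE)
    have "(int x + int d) mod int n = int ((x + d) mod n)" by (simp add: zmod_int)
    then show "e \<in> ?f ` Sigma {1..k} ?A"
      using x e by (intro image_eqI[of _ _ "(d, int x)"]) auto
  qed
  have fin: "finite (?A d)" for d by (rule finite_subset[of _ "{0..<int n}"]) auto
  have "finite (Sigma {1..k} ?A)" using fin by (intro finite_SigmaI) auto
  then have "card (edges H) \<le> card (Sigma {1..k} ?A)" using sub by (rule surj_card_le)
  also have "\<dots> = (\<Sum>d=1..k. card (?A d))" using fin by (intro card_SigmaI) auto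
  finally have "real (card (edges H)) \<le> (\<Sum>d=1..k. real (card (?A d)))"
    by (simp flip: of_nat_sum)
  moreover have "real (card (?A d)) = shift_edges H n (int d)" for d
  proof -
    have "?A d = {0..<int n} \<inter> {x. {nat (x mod int n), nat ((x + int d) mod int n)} \<in> edges H}"
      by auto
    then show ?thesis
      by (simp only: shift_edges_def sum_of_bool_eq finite_atLeastLessThan_int)
  qed
  ultimately show ?thesis by simp
qed

text \<open>\<open>shift_edges H n\<close> is nonnegative, even and at most \<open>n\<close>, and it
  satisfies the five-point bound with \<open>B = 6 * n\<close>. In \<open>window_sum_le\<close> the
  factor becomes \<open>7 / 10 * 6 = 7 * (3 / 5)\<close>.\<close>

lemma card_edges_triangle_free_le:
  assumes H: "subgraph H (cycle_power n k)" and free: "free_of (complete_graph 3) H"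
  shows "real (card (edges H)) \<le> (3 / 5 * real k + 223) * real n"
proof (cases "n = 0")
  case True
  then have "edges H = {}"
    using H by (fastforce simp: subgraph_def elim: edges_cycle_powerE)
  then show ?thesis by simp
next
  case False
  then have n: "n > 0" by simp
  have sH: "simple_graph H" using H by (simp add: subgraph_def)
  have five: "(\<Sum>b<5. \<Sum>a<b. shift_edges H n (q b - q a)) \<le> 6 * real n" for q :: "nat \<Rightarrow> int"
  proof -
    let ?E = "\<lambda>x y. {nat (x mod int n), nat (y mod int n)} \<in> edges H"
    have "(\<Sum>b<5. \<Sum>a<b. shift_edges H n (q b - q a))
        = (\<Sum>b<5. \<Sum>a<b. \<Sum>x\<in>{0..<int n}. of_bool (?E (x + q a) (x + q b)))"
      by (simp add: shift_edges_translate[OF n])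
    also have "\<dots> = (\<Sum>x\<in>{0..<int n}. \<Sum>b<5. \<Sum>a<b. of_bool (?E (x + q a) (x + q b)))"
      by (simp only: sum_pairs_less_5 sum.distrib)
    also have "\<dots> \<le> (\<Sum>x\<in>{0..<int n}. 6)"
    proof (rule sum_mono)
      fix x
      show "(\<Sum>b<5. \<Sum>a<b. of_bool (?E (x + q a) (x + q b))) \<le> (6::real)"
        using contains_triangleI[OF _ _ _ sH] free
        by (intro triangle_free_five_points[of ?E "\<lambda>a. x + q a"]) blast
    qed
    finally show ?thesis by simp
  qed
  have "shift_edges H n y \<le> (\<Sum>x\<in>{0..<int n}. 1)" for y
    unfolding shift_edges_def by (intro sum_mono) simp
  then have le: "shift_edges H n y \<le> real n" for y by simp
  have ge: "shift_edges H n y \<ge> 0" for y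
    unfolding shift_edges_def by (intro sum_nonneg) simp
  have "real (card (edges H)) \<le> 7 / 10 * real (k div 7) * (6 * real n) + 223 * real n"
    using card_edges_le_shift_edges[OF H]
      window_sum_le[of "shift_edges H n", OF ge shift_edges_minus[OF n] five le, of k]
    by linarith
  also have "\<dots> = (3 / 5 * (7 * real (k div 7)) + 223) * real n" by (simp add: algebra_simps)
  also have "\<dots> \<le> (3 / 5 * real k + 223) * real n"
  proof -
    have "7 * real (k div 7) \<le> real k" by linarith
    then show ?thesis by (intro mult_right_mono) auto
  qed
  finally show ?thesis .
qed

section \<open>Minimum degree\<close>

text \<open>Charges each vertex of \<open>W\<close> to a member of \<open>A\<close> that misses
  it.\<close>

lemma card_le_sum_card_missed:
  assumes "finite A" "finite W" "\<And>w. w \<in> W \<Longrightarrow> \<exists>v\<in>A. \<not> E v w"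
  shows "card W \<le> (\<Sum>v\<in>A. card {w\<in>W. \<not> E v w})"
proof -
  have "W \<subseteq> (\<Union>v\<in>A. {w\<in>W. \<not> E v w})" using assms(3) by blast
  then have "card W \<le> card (\<Union>v\<in>A. {w\<in>W. \<not> E v w})"
    using assms by (intro card_mono) auto
  also have "\<dots> \<le> (\<Sum>v\<in>A. card {w\<in>W. \<not> E v w})" by (rule card_UN_le[OF assms(1)])
  finally show ?thesis .
qed

text \<open>A subgraph of a cycle power, lifted to the integers; \<open>s\<close> bounds the number of non-neighbours
  of a vertex within distance \<open>k\<close>.\<close>

locale banded_graph =
  fixes E :: "int \<Rightarrow> int \<Rightarrow> bool" and V :: "int set" and k s :: nat
  assumes sym: "E x y \<Longrightarrow> E y x"
    and irrefl: "\<not> E x x"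
    and band: "E x y \<Longrightarrow> \<bar>x - y\<bar> \<le> int k"
    and closed: "E x y \<Longrightarrow> y \<in> V"
    and missing: "x \<in> V \<Longrightarrow> card {y. y \<noteq> x \<and> \<bar>y - x\<bar> \<le> int k \<and> \<not> E x y} \<le> s"
begin

definition clique :: "int set \<Rightarrow> bool" where
  "clique A \<longleftrightarrow> finite A \<and> A \<subseteq> V \<and> (\<forall>x\<in>A. \<forall>y\<in>A. x \<noteq> y \<longrightarrow> E x y)"

definition missed_inside :: "int set \<Rightarrow> int \<Rightarrow> int \<Rightarrow> int" where
  "missed_inside A a b = int (\<Sum>v\<in>A. card {w\<in>{a..b} - A. \<not> E v w})"

text \<open>The last inequality is what makes the clique growable: it bounds the number of non-members
  inside the span, up to credit for non-adjacencies already spent there. A shortest edge earns its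
  credit because both ends miss every vertex in between.\<close>

definition tight :: "int set \<Rightarrow> int \<Rightarrow> int \<Rightarrow> bool" where
  "tight A a b \<longleftrightarrow> clique A \<and> A \<subseteq> {a..b} \<and> a \<in> A \<and> b \<in> A \<and> a < b \<and>
     (\<forall>w\<in>{a..b} - A. \<exists>v\<in>A. \<not> E v w) \<and>
     2 * (b - a + 1 - int (card A)) - missed_inside A a b \<le> (int (card A) - 2) * int s"

lemma card_window_missed_le:
  assumes "clique A" "v \<in> A" and W: "\<And>w. w \<in> W \<Longrightarrow> w \<noteq> v \<and> \<bar>w - v\<bar> \<le> int k"
  shows "card {w\<in>W. \<not> E v w} \<le> s"
proof -
  have fin: "finite {y. y \<noteq> v \<and> \<bar>y - v\<bar> \<le> int k \<and> \<not> E v y}"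
    by (rule finite_subset[of _ "{v - int k..v + int k}"]) auto
  have "card {w\<in>W. \<not> E v w} \<le> card {y. y \<noteq> v \<and> \<bar>y - v\<bar> \<le> int k \<and> \<not> E v y}"
    using W by (intro card_mono[OF fin]) auto
  also have "\<dots> \<le> s" using assms missing by (auto simp: clique_def)
  finally show ?thesis .
qed

text \<open>The \<open>2 * r\<close> vertices just outside the span are each missed by some member
  of \<open>A\<close>, and all of them are within distance \<open>k\<close> of every member. So they
  share with the misses inside the span the budget of \<open>s\<close> misses per member.\<close>

lemma missed_inside_add_sides_le:
  fixes r :: nat
  assumes t: "tight A a b" and r: "b - a + int r \<le> int k"
    and out: "\<And>e. 1 \<le> e \<Longrightarrow> e \<le> int r \<Longrightarrow> (\<exists>v\<in>A. \<not> E v (a - e)) \<and> (\<exists>v\<in>A. \<not> E v (b + e))"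
  shows "missed_inside A a b + 2 * int r \<le> int (card A) * int s"
proof -
  let ?W1 = "{a..b} - A" and ?W2 = "{a - int r..<a} \<union> {b<..b + int r}"
  have A: "clique A" "finite A" "A \<subseteq> {a..b}" "a < b" using t by (auto simp: tight_def clique_def)
  have "\<exists>v\<in>A. \<not> E v w" if "w \<in> ?W2" for w
  proof (cases "w < a")
    case True then show ?thesis using out[of "a - w"] that A by auto
  next
    case False then show ?thesis using out[of "w - b"] that A by auto
  qed
  then have "card ?W2 \<le> (\<Sum>v\<in>A. card {w\<in>?W2. \<not> E v w})"
    using A by (intro card_le_sum_card_missed) auto
  moreover have "card ?W2 = 2 * r" using A by (subst card_Un_disjoint) auto
  ultimately have "missed_inside A a b + 2 * int r
      \<le> int (\<Sum>v\<in>A. card {w\<in>?W1. \<not> E v w} + card {w\<in>?W2. \<not> E v w})"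
    unfolding missed_inside_def sum.distrib of_nat_add by linarith
  also have "\<dots> \<le> int (\<Sum>v\<in>A. s)"
  proof (intro zle_int[THEN iffD2] sum_mono)
    fix v assume v: "v \<in> A"
    have "card {w\<in>?W1. \<not> E v w} + card {w\<in>?W2. \<not> E v w} = card ({w\<in>?W1. \<not> E v w} \<union> {w\<in>?W2. \<not> E v w})"
      using A by (intro card_Un_disjoint[symmetric] finite_subset[of "{w\<in>_. _ w}" "{a - int r..b + int r}"]) auto
    also have "{w\<in>?W1. \<not> E v w} \<union> {w\<in>?W2. \<not> E v w} = {w\<in>?W1 \<union> ?W2. \<not> E v w}" by blast
    also have "card \<dots> \<le> s"
      using A v r by (intro card_window_missed_le[of A]) (auto dest!: subsetD)
    finally show "card {w\<in>?W1. \<not> E v w} + card {w\<in>?W2. \<not> E v w} \<le> s" .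
  qed
  finally show ?thesis by simp
qed

text \<open>Adding \<open>bound\<close> to the old inequality cancels
  \<open>missed_inside A a b\<close> and bounds twice the number of new non-members by twice the
  required right-hand side. Each non-member is missed at least once, so the new
  \<open>missed_inside\<close> pays for one of the two copies.\<close>

lemma tight_insert:
  assumes t: "tight A a b" and e: "1 \<le> e"
    and x: "(x = a - e \<and> a' = x \<and> b' = b) \<or> (x = b + e \<and> a' = a \<and> b' = x)"
    and adj: "\<And>v. v \<in> A \<Longrightarrow> E v x"
    and out: "\<And>d. 1 \<le> d \<Longrightarrow> d < e \<Longrightarrow> (\<exists>v\<in>A. \<not> E v (a - d)) \<and> (\<exists>v\<in>A. \<not> E v (b + d))"
    and bound: "missed_inside A a b + 2 * (e - 1) \<le> int (card A) * int s"
  shows "tight (insert x A) a' b'"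
proof -
  let ?A = "insert x A"
  have A: "clique A" "finite A" "A \<subseteq> {a..b}" "a < b" "a \<in> A" "b \<in> A" "A \<noteq> {}"
    using t by (auto simp: tight_def clique_def)
  have xA: "x \<notin> A" using x A e by auto
  have span: "?A \<subseteq> {a'..b'}" "a' \<in> ?A" "b' \<in> ?A" "a' < b'" "b' - a' = b - a + e"
    using x A e by auto
  have cl: "clique ?A"
    using A adj sym closed unfolding clique_def by blast
  have cover: "\<forall>w\<in>{a'..b'} - ?A. \<exists>v\<in>?A. \<not> E v w"
  proof
    fix w assume w: "w \<in> {a'..b'} - ?A"
    show "\<exists>v\<in>?A. \<not> E v w"
    proof (cases "w \<in> {a..b}")
      case True then show ?thesis using t w by (auto simp: tight_def)
    next
      case False
      then show ?thesis using out[of "a - w"] out[of "w - b"] x w by fastforce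
    qed
  qed
  have "card ({a'..b'} - ?A) \<le> (\<Sum>v\<in>?A. card {w\<in>{a'..b'} - ?A. \<not> E v w})"
    using A cover by (intro card_le_sum_card_missed) auto
  moreover have "int (card ({a'..b'} - ?A)) = b' - a' + 1 - int (card ?A)"
    using span A card_mono[OF _ span(1)] by (subst card_Diff_subset) (auto simp: of_nat_diff)
  ultimately have M: "b' - a' + 1 - int (card ?A) \<le> missed_inside ?A a' b'"
    unfolding missed_inside_def by linarith
  have c: "int (card ?A) = int (card A) + 1" using A xA by simp
  have "2 * (b - a + 1 - int (card A)) - missed_inside A a b \<le> (int (card A) - 2) * int s"
    using t by (simp add: tight_def)
  then have "2 * (b' - a' + 1 - int (card ?A)) \<le> 2 * ((int (card ?A) - 2) * int s)"
    using bound unfolding c span(5) by (simp add: algebra_simps)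
  then show ?thesis unfolding tight_def using cl span cover M by auto
qed

text \<open>If neither side had a common neighbour up to distance \<open>k - (b - a)\<close> from
  the span, \<open>missed_inside_add_sides_le\<close> and the \<open>tight\<close> inequality would
  add up to \<open>k \<le> (card A - 1) * (s + 1)\<close>. Choosing the nearest one on either side
  keeps every skipped vertex missed.\<close>

lemma tight_extend:
  assumes t: "tight A a b" and small: "(int (card A) - 1) * (int s + 1) < int k"
  shows "\<exists>x a' b'. x \<notin> A \<and> tight (insert x A) a' b'"
proof -
  let ?P = "\<lambda>e::nat. 1 \<le> e \<and> ((\<forall>v\<in>A. E v (a - int e)) \<or> (\<forall>v\<in>A. E v (b + int e)))"
  have A: "clique A" "finite A" "A \<subseteq> {a..b}" "a < b" "a \<in> A" "b \<in> A"
    using t by (auto simp: tight_def clique_def)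
  have ab: "b - a \<le> int k" using A band[of a b] unfolding clique_def by force
  have I: "2 * (b - a + 1 - int (card A)) - missed_inside A a b \<le> (int (card A) - 2) * int s"
    using t by (simp add: tight_def)
  have "\<exists>e. ?P e"
  proof (rule ccontr)
    assume "\<not> ?thesis"
    then have *: "\<not> ?P (nat e)" for e by blast
    then have n: "(\<exists>v\<in>A. \<not> E v (a - e)) \<and> (\<exists>v\<in>A. \<not> E v (b + e))" if "1 \<le> e" for e
      using that *[of e] by auto
    have "missed_inside A a b + 2 * int (nat (int k - (b - a))) \<le> int (card A) * int s"
      using ab n by (intro missed_inside_add_sides_le[OF t]) auto
    then show False using I small ab by (simp add: algebra_simps)
  qed
  then have P: "?P (LEAST e. ?P e)" by (rule LeastI_ex)
  define e where "e = (LEAST e. ?P e)"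
  have least: "\<not> ?P d" if "d < e" for d using that not_less_Least unfolding e_def by blast
  have out: "(\<exists>v\<in>A. \<not> E v (a - d)) \<and> (\<exists>v\<in>A. \<not> E v (b + d))" if "1 \<le> d" "d < int e" for d
    using least[of "nat d"] that by auto
  have Pe: "?P e" using P unfolding e_def .
  \<comment> \<open>The new vertex is adjacent to the opposite end of the span, so all skipped
    vertices are within reach; only the \<open>e - 1\<close> positions before it are
    counted.\<close>
  then have "b - a + int e \<le> int k" using A band[of b "a - int e"] band[of a "b + int e"] by auto
  then have "missed_inside A a b + 2 * int (e - 1) \<le> int (card A) * int s"
    using Pe out by (intro missed_inside_add_sides_le[OF t]) auto
  then have bound: "missed_inside A a b + 2 * (int e - 1) \<le> int (card A) * int s"
    using Pe by simp
  show ?thesis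
  proof (cases "\<forall>v\<in>A. E v (a - int e)")
    case True
    then show ?thesis
      using tight_insert[OF t _ _ _ out bound, of "a - int e" "a - int e" b] Pe A
      by (intro exI[of _ "a - int e"] exI[of _ b]) auto
  next
    case False
    then have "\<forall>v\<in>A. E v (b + int e)" using Pe by blast
    then show ?thesis
      using tight_insert[OF t _ _ _ out bound, of "b + int e" a "b + int e"] Pe A
      by (intro exI[of _ "b + int e"] exI[of _ a]) auto
  qed
qed

text \<open>With two members the right-hand side of the \<open>tight\<close> inequality is
  \<open>0\<close>; by minimality both ends miss the \<open>b - a - 1\<close> vertices in between,
  so the left-hand side is \<open>0\<close> too.\<close>

lemma tight_shortest_edge:
  assumes "V \<noteq> {}" "s < 2 * k"
  shows "\<exists>a b. a < b \<and> tight {a, b} a b"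
proof -
  let ?P = "\<lambda>d::nat. \<exists>x. E x (x + int d)"
  have "\<exists>d. ?P d"
  proof -
    obtain v where v: "v \<in> V" using assms by blast
    have "\<exists>w. E v w"
    proof (rule ccontr)
      assume "\<not> ?thesis"
      then have "{y. y \<noteq> v \<and> \<bar>y - v\<bar> \<le> int k \<and> \<not> E v y} = {v - int k..v + int k} - {v}" by auto
      then show False using missing[OF v] assms(2) by (simp add: card_Diff_singleton)
    qed
    then obtain w where w: "E v w" by blast
    show ?thesis
    proof (cases "v \<le> w")
      case True then show ?thesis using w by (intro exI[of _ "nat (w - v)"] exI[of _ v]) simp
    next
      case False then show ?thesis using sym[OF w] by (intro exI[of _ "nat (v - w)"] exI[of _ w]) simp
    qed
  qed
  then have P: "?P (LEAST d. ?P d)" by (rule LeastI_ex)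
  define d where "d = (LEAST d. ?P d)"
  obtain a where a: "E a (a + int d)" using P unfolding d_def by blast
  define b where "b = a + int d"
  have "d \<noteq> 0" using a irrefl by (intro notI) simp
  then have ab: "a < b" by (simp add: b_def)
  have no: "\<not> E x y" if "0 \<le> y - x" "y - x < b - a" for x y
  proof
    assume "E x y"
    then have "?P (nat (y - x))" using that by (intro exI[of _ x]) simp
    moreover have "nat (y - x) < d" using that b_def by simp
    ultimately show False using not_less_Least unfolding d_def by blast
  qed
  have W: "\<not> E a w" "\<not> E b w" if "w \<in> {a..b} - {a, b}" for w
    using no[where x = a and y = w] no[where x = w and y = b] sym[of b w] that by auto
  have "missed_inside {a, b} a b = 2 * (b - a - 1)"
  proof -
    have "{w\<in>{a..b} - {a, b}. \<not> E v w} = {a<..<b}" if "v \<in> {a, b}" for v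
      using W that by auto
    then show ?thesis using ab by (simp add: missed_inside_def)
  qed
  moreover have "clique {a, b}"
    using a sym[OF a] closed[OF a] closed[OF sym[OF a]] unfolding clique_def b_def by auto
  ultimately have "tight {a, b} a b"
    unfolding tight_def using ab W by auto
  then show ?thesis using ab by blast
qed

text \<open>Extending a clique of \<open>j + 2\<close> members needs
  \<open>(j + 1) * (s + 1) < k\<close>; for the last extension, \<open>j = m - 1\<close>, this is
  the assumption.\<close>

lemma exists_clique:
  assumes "V \<noteq> {}" "m \<ge> 1" "m * (s + 1) < k"
  shows "\<exists>A. clique A \<and> card A = m + 2"
proof -
  have "\<exists>A a b. tight A a b \<and> card A = j + 2" if "j \<le> m" for j
    using that
  proof (induction j)
    case 0
    have "1 * (s + 1) \<le> m * (s + 1)" using assms by (intro mult_right_mono) auto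
    then have "s < 2 * k" using assms(3) by simp
    then obtain a b where "a < b" "tight {a, b} a b" using tight_shortest_edge assms by blast
    then show ?case by (intro exI[of _ "{a, b}"] exI[of _ a] exI[of _ b]) auto
  next
    case (Suc j)
    then obtain A a b where A: "tight A a b" "card A = j + 2" by auto
    have "(j + 1) * (s + 1) \<le> m * (s + 1)" using Suc by (intro mult_right_mono) auto
    then have "int ((j + 1) * (s + 1)) < int k" using assms(3) by linarith
    then have "(int (card A) - 1) * (int s + 1) < int k" using A by (simp add: algebra_simps)
    then obtain x a' b' where x: "x \<notin> A" "tight (insert x A) a' b'" using tight_extend[OF A(1)] by blast
    have "finite A" using A by (simp add: tight_def clique_def)
    then have "card (insert x A) = Suc j + 2" using x A by simp
    then show ?case using x by blast
  qed
  then show ?thesis using tight_def by blast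
qed

end

text \<open>The cycle is unrolled: integers are adjacent if they are at most \<open>k\<close> apart
  and their residues are adjacent in \<open>H\<close>. Every edge at \<open>g x\<close> lifts to an
  edge at \<open>x\<close>, so at most \<open>2 * k - minimum_degree H\<close> positions are missed,
  and the degree assumption amounts to \<open>m * (s + 1) < k\<close>.\<close>

lemma contains_complete_graph_if_minimum_degree:
  fixes m :: nat
  assumes H: "subgraph H (cycle_power n k)" "verts H \<noteq> {}" and m: "m \<ge> 1"
    and deg: "real (minimum_degree H) > (2 - 1 / real m) * real k + 1"
  shows "contains_copy (complete_graph (m + 2)) H"
proof -
  have sH: "simple_graph H" and vH: "verts H \<subseteq> {..<n}" and finH: "finite (verts H)"
    using H(1) by (auto simp: subgraph_def simple_graph_def)
  have n: "n > 0" using H(2) vH by auto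
  define g where "g = (\<lambda>x. nat (x mod int n))"
  have gn: "g x < n" for x using n by (simp add: g_def nat_less_iff)
  have g_int: "g (int u) = u" if "u < n" for u using that by (simp add: g_def zmod_int[symmetric])
  define E where "E = (\<lambda>x y. \<bar>x - y\<bar> \<le> int k \<and> {g x, g y} \<in> edges H)"
  define V where "V = {x. g x \<in> verts H}"
  define s where "s = 2 * k - minimum_degree H"
  have in_verts: "u \<in> verts H \<and> v \<in> verts H" if "{u, v} \<in> edges H" for u v
    using that sH unfolding simple_graph_def by blast
  have irr: "\<not> E x x" for x
    using sH unfolding E_def simple_graph_def by fastforce
  have degree_le: "minimum_degree H \<le> card {y. E x y}" if "x \<in> V" for x
  proof -
    have fin: "finite {y. E x y}"
      by (rule finite_subset[of _ "{x - int k..x + int k}"]) (auto simp: E_def)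
    have "minimum_degree H \<le> degree H (g x)"
      unfolding minimum_degree_def using that finH by (intro Min_le) (auto simp: V_def)
    also have "\<dots> \<le> card {y. E x y}"
      unfolding degree_def
    proof (rule surj_card_le[OF fin, of _ "\<lambda>y. {g x, g y}"], rule subsetI)
      fix e assume e: "e \<in> {e \<in> edges H. g x \<in> e}"
      then have "e \<in> edges (cycle_power n k)" using H(1) by (auto simp: subgraph_def)
      then obtain u d where u: "u < n" "d \<le> k" "e = {u, (u + d) mod n}" by (rule edges_cycle_powerE)
      show "e \<in> (\<lambda>y. {g x, g y}) ` {y. E x y}"
      proof (cases "g x = u")
        case True
        have "g (x + int d) = nat ((int (g x) + int d) mod int n)"
          using n by (simp add: g_def mod_add_left_eq)
        also have "\<dots> = (u + d) mod n" using True by (simp add: nat_mod_distrib nat_add_distrib)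
        finally show ?thesis using u e True
          by (intro image_eqI[of _ _ "x + int d"]) (auto simp: E_def)
      next
        case False
        then have gx: "g x = (u + d) mod n" using e u by auto
        have "(x - int d) mod int n = (int (g x) - int d) mod int n"
          using n by (simp add: g_def mod_diff_left_eq)
        also have "\<dots> = int u"
          using u by (simp add: gx zmod_int mod_diff_left_eq)
        finally have "g (x - int d) = u" by (simp add: g_def)
        then show ?thesis using u e gx
          by (intro image_eqI[of _ _ "x - int d"]) (auto simp: E_def insert_commute)
      qed
    qed
    finally show ?thesis .
  qed
  have window: "card {y. y \<noteq> x \<and> \<bar>y - x\<bar> \<le> int k \<and> \<not> E x y} = 2 * k - card {y. E x y}"
    "card {y. E x y} \<le> 2 * k" for x
  proof -
    let ?W = "{x - int k..x + int k} - {x}"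
    have W: "card ?W = 2 * k" by (simp add: card_Diff_singleton)
    have sub: "{y. E x y} \<subseteq> ?W" using irr by (auto simp: E_def)
    then show "card {y. E x y} \<le> 2 * k" using card_mono[of ?W] W by auto
    have "{y. y \<noteq> x \<and> \<bar>y - x\<bar> \<le> int k \<and> \<not> E x y} = ?W - {y. E x y}" by auto
    then show "card {y. y \<noteq> x \<and> \<bar>y - x\<bar> \<le> int k \<and> \<not> E x y} = 2 * k - card {y. E x y}"
      using card_Diff_subset[OF finite_subset[OF sub] sub] W by simp
  qed
  interpret banded_graph E V k s
  proof
    show "E y x" if "E x y" for x y using that by (auto simp: E_def insert_commute abs_minus_commute)
    show "\<bar>x - y\<bar> \<le> int k" if "E x y" for x y using that by (simp add: E_def)
    show "y \<in> V" if "E x y" for x y using that in_verts by (auto simp: E_def V_def)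
    show "card {y. y \<noteq> x \<and> \<bar>y - x\<bar> \<le> int k \<and> \<not> E x y} \<le> s" if "x \<in> V" for x
      using degree_le[OF that] unfolding window s_def by simp
  qed (rule irr)
  obtain u where u: "u \<in> verts H" using H(2) by blast
  then have uV: "int u \<in> V" using vH g_int by (auto simp: V_def)
  \<comment> \<open>Ensures that the natural subtraction in \<open>s\<close> does not
    truncate.\<close>
  have "minimum_degree H \<le> 2 * k" using degree_le[OF uV] window(2) order_trans by blast
  then have "real s = 2 * real k - real (minimum_degree H)" by (simp add: s_def of_nat_diff)
  then have "real s + 1 < real k / real m" using deg by (simp add: algebra_simps)
  then have "real m * (real s + 1) < real k" using m by (simp add: field_simps)
  then have "real (m * (s + 1)) < real k" by (simp add: algebra_simps)
  then have "m * (s + 1) < k" by (simp only: of_nat_less_iff)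
  then obtain A where A: "clique A" "card A = m + 2" using exists_clique uV m by blast
  show ?thesis
  proof (rule contains_complete_graphI[OF sH, of A _ g])
    show "{g x, g y} \<in> edges H" if "x \<in> A" "y \<in> A" "x \<noteq> y" for x y
    proof -
      have "E x y" using A(1) that unfolding clique_def by blast
      then show ?thesis by (simp add: E_def)
    qed
    show "finite A" using A(1) unfolding clique_def by blast
    have "A \<subseteq> V" using A(1) unfolding clique_def by blast
    then show "g ` A \<subseteq> verts H" by (auto simp: V_def)
  qed (rule A(2))
qed

section \<open>Block colourings\<close>

text \<open>The seam between \<open>n - 1\<close> and \<open>0\<close> carries no edges, which costs only \<open>O(k\<^sup>2)\<close> edges and makes
  every \<open>n\<close> admissible.\<close>

definition block_graph :: "nat \<Rightarrow> nat \<Rightarrow> nat \<Rightarrow> nat \<Rightarrow> nat graph" where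
  "block_graph n k L r = Graph {..<n}
     {{x, y} | x y. x < y \<and> y < n \<and> y \<le> x + k \<and> (x div L) mod r \<noteq> (y div L) mod r}"

lemma verts_block_graph [simp]: "verts (block_graph n k L r) = {..<n}"
  by (simp add: block_graph_def)

lemma block_graph_edge_colour:
  assumes "{u, v} \<in> edges (block_graph n k L r)"
  shows "(u div L) mod r \<noteq> (v div L) mod r"
  using assms by (auto simp: block_graph_def doubleton_eq_iff)

lemma subgraph_block_graph: "subgraph (block_graph n k L r) (cycle_power n k)"
proof -
  have "{x, y} \<in> edges (cycle_power n k)" if "x < y" "y < n" "y \<le> x + k" for x y
    using that by (subst cycle_power_edge_iff) (auto intro!: exI[of _ "y - x"])
  then show ?thesis
    unfolding subgraph_def simple_graph_def by (auto simp: block_graph_def)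
qed

lemma block_graph_free:
  assumes "r > 0"
  shows "free_of (complete_graph (Suc r)) (block_graph n k L r)"
proof
  assume "contains_copy (complete_graph (Suc r)) (block_graph n k L r)"
  then obtain f where f: "\<forall>e \<in> edges (complete_graph (Suc r)). f ` e \<in> edges (block_graph n k L r)"
    unfolding contains_copy_def by blast
  let ?c = "\<lambda>i. (f i div L) mod r"
  have "inj_on ?c {..<Suc r}"
  proof (rule inj_onI, rule ccontr)
    fix i j assume ij: "i \<in> {..<Suc r}" "j \<in> {..<Suc r}" "?c i = ?c j" "i \<noteq> j"
    then have "{i, j} \<in> edges (complete_graph (Suc r))" by (auto simp: complete_graph_def)
    then have "{f i, f j} \<in> edges (block_graph n k L r)" using f by force
    then show False using block_graph_edge_colour ij(3) by blast
  qed
  moreover have "?c ` {..<Suc r} \<subseteq> {..<r}" using assms by auto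
  ultimately have "card {..<Suc r} \<le> card {..<r}" by (intro card_inj_on_le) auto
  then show False by simp
qed

text \<open>A later vertex of the same colour lies in the rest of block \<open>q\<close>, or in
  block \<open>q + r\<close> or beyond. The second term is a truncated subtraction, hence
  \<open>0\<close> if the window ends before \<open>(q + r) * L\<close>.\<close>

lemma card_same_colour_le:
  assumes L: "L > 0" and p: "p < L" and k: "k \<le> r * L"
  shows "card {y\<in>{q * L + p<..q * L + p + k}. (y div L) mod r = q mod r}
    \<le> (L - 1 - p) + (k + p + 1 - r * L)"
proof -
  have "{y\<in>{q * L + p<..q * L + p + k}. (y div L) mod r = q mod r}
    \<subseteq> {q * L + p<..<(q + 1) * L} \<union> {(q + r) * L..q * L + p + k}"
  proof
    fix y assume y: "y \<in> {y\<in>{q * L + p<..q * L + p + k}. (y div L) mod r = q mod r}"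
    define q' where "q' = y div L"
    have q': "q' * L \<le> y" "y < (q' + 1) * L"
      using L by (simp_all add: q'_def dividend_less_times_div algebra_simps)
    have "q * L < (q' + 1) * L" using q' y p by simp
    then have "q \<le> q'" by (simp only: mult_less_cancel2) simp
    moreover have "q' mod r = q mod r" using y by (simp add: q'_def)
    ultimately have dv: "r dvd q' - q" by (simp add: mod_eq_dvd_iff_nat)
    show "y \<in> {q * L + p<..<(q + 1) * L} \<union> {(q + r) * L..q * L + p + k}"
    proof (cases "q' = q")
      case True then show ?thesis using y q' by simp
    next
      case False
      then have "r \<le> q' - q" using dv \<open>q \<le> q'\<close> by (intro dvd_imp_le) auto
      then have "(q + r) * L \<le> q' * L" using \<open>q \<le> q'\<close> by (intro mult_right_mono) auto
      then have "(q + r) * L \<le> y" using q'(1) by (rule order_trans)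
      then show ?thesis using y by simp
    qed
  qed
  then have "card {y\<in>{q * L + p<..q * L + p + k}. (y div L) mod r = q mod r}
    \<le> card ({q * L + p<..<(q + 1) * L} \<union> {(q + r) * L..q * L + p + k})"
    by (intro card_mono) auto
  also have "\<dots> \<le> card {q * L + p<..<(q + 1) * L} + card {(q + r) * L..q * L + p + k}"
    by (rule card_Un_le)
  also have "\<dots> \<le> (L - 1 - p) + (k + p + 1 - r * L)"
    by (simp add: algebra_simps)
  finally show ?thesis .
qed

text \<open>Two triangular sums: the rest of the block contributes \<open>0, ..., L - 1\<close>, and
  with \<open>u = k - m * L\<close> the block \<open>m + 1\<close> further on contributes
  \<open>1, ..., u\<close> at the last \<open>u\<close> positions. Doubling avoids division in the
  naturals.\<close>

lemma sum_same_colour_bound: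
  fixes m L k :: nat
  assumes k: "m * L \<le> k" "k \<le> (m + 1) * L"
  shows "2 * (\<Sum>p<L. (L - 1 - p) + (k + p + 1 - (m + 1) * L)) = L * (L - 1) + (k - m * L) * (k - m * L + 1)"
proof -
  define u where "u = k - m * L"
  have u: "u \<le> L" "k = m * L + u" using k by (simp_all add: u_def add_mult_distrib)
  have tri: "2 * (\<Sum>i<n. i) = n * (n - 1)" for n :: nat
    by (induction n) (auto simp: algebra_simps diff_mult_distrib2)
  have "k + p + 1 - (m + 1) * L = u + p + 1 - L" for p using u by (simp add: add_mult_distrib)
  then have "(\<Sum>p<L. (L - 1 - p) + (k + p + 1 - (m + 1) * L)) = (\<Sum>p<L. L - 1 - p) + (\<Sum>p<L. u + p + 1 - L)"
    by (simp only: sum.distrib)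
  also have "(\<Sum>p<L. L - 1 - p) = (\<Sum>i<L. i)"
    by (rule sum.reindex_bij_witness[of _ "\<lambda>i. L - 1 - i" "\<lambda>i. L - 1 - i"]) auto
  also have "(\<Sum>p<L. u + p + 1 - L) = (\<Sum>p\<in>{L - u..<L}. u + p + 1 - L)"
    by (rule sum.mono_neutral_right) auto
  also have "\<dots> = (\<Sum>i<Suc u. i)"
  proof (rule sum.reindex_bij_witness_not_neutral[of "{}" "{0}" _ "\<lambda>i. i + L - u - 1" "\<lambda>p. u + p + 1 - L"])
  qed (use u in auto)
  finally have "2 * (\<Sum>p<L. (L - 1 - p) + (k + p + 1 - (m + 1) * L)) = L * (L - 1) + Suc u * u"
    using tri[of L] tri[of "Suc u"] by simp
  then show ?thesis by (simp add: u_def mult.commute)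
qed

text \<open>Edges are counted by their smaller endpoint in the first \<open>Q\<close> blocks;
  \<open>Q * L + k \<le> n\<close> keeps the window of each such vertex inside the vertex set. Each
  block loses at most the number of pairs given by \<open>sum_same_colour_bound\<close>.\<close>

lemma card_edges_block_graph_ge:
  assumes L: "L > 0" and k: "m * L \<le> k" "k \<le> (m + 1) * L" and Q: "Q * L + k \<le> n"
  shows "real Q * (real L * real k - (real L * (real L - 1)
      + (real k - real m * real L) * (real k - real m * real L + 1)) / 2)
    \<le> real (card (edges (block_graph n k L (m + 1))))"
proof -
  let ?c = "\<lambda>x. (x div L) mod (m + 1)"
  let ?Y = "\<lambda>x. {y\<in>{x<..x + k}. ?c x \<noteq> ?c y}"
  let ?B = "\<lambda>p. (L - 1 - p) + (k + p + 1 - (m + 1) * L)"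
  let ?f = "\<lambda>(x, y). {x, y}"
  have inj: "inj_on ?f (Sigma {..<Q * L} ?Y)"
    by (rule inj_onI) (auto simp: doubleton_eq_iff)
  have sub: "?f ` Sigma {..<Q * L} ?Y \<subseteq> edges (block_graph n k L (m + 1))"
    using Q by (force simp: block_graph_def)
  have fin: "finite (edges (block_graph n k L (m + 1)))"
    using finite_edges_subgraph[OF subgraph_block_graph] .
  have Y: "real k - real (?B p) \<le> real (card (?Y (q * L + p)))" if "p < L" for p q
  proof -
    let ?S = "{y\<in>{q * L + p<..q * L + p + k}. (y div L) mod (m + 1) = q mod (m + 1)}"
    have c: "?c (q * L + p) = q mod (m + 1)" using that L by simp
    have "?Y (q * L + p) = {q * L + p<..q * L + p + k} - ?S" unfolding c by auto
    moreover have "card ({q * L + p<..q * L + p + k} - ?S) = k - card ?S"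
      by (subst card_Diff_subset) auto
    ultimately have "card (?Y (q * L + p)) = k - card ?S" by simp
    moreover have "card ?S \<le> ?B p" using card_same_colour_le[OF L that k(2)] .
    ultimately show ?thesis by linarith
  qed
  have B: "real (\<Sum>p<L. ?B p) = (real L * (real L - 1)
      + (real k - real m * real L) * (real k - real m * real L + 1)) / 2"
  proof -
    have "2 * real (\<Sum>p<L. ?B p) = real (2 * (\<Sum>p<L. ?B p))" by simp
    also have "\<dots> = real (L * (L - 1) + (k - m * L) * (k - m * L + 1))"
      by (simp only: sum_same_colour_bound[OF k])
    also have "\<dots> = real L * real (L - 1) + real (k - m * L) * (real (k - m * L) + 1)"
      by (simp only: of_nat_add of_nat_mult of_nat_1)
    also have "real (L - 1) = real L - 1" using L by simp
    also have "real (k - m * L) = real k - real m * real L" using k by (simp add: of_nat_diff)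
    finally show ?thesis by simp
  qed
  have "(\<Sum>p<L. real k - real (?B p)) = real L * real k - real (\<Sum>p<L. ?B p)"
    by (simp only: sum_subtractf of_nat_sum sum_constant card_lessThan)
  then have "real Q * (real L * real k - (real L * (real L - 1)
      + (real k - real m * real L) * (real k - real m * real L + 1)) / 2)
    = (\<Sum>q<Q. \<Sum>p<L. real k - real (?B p))"
    by (simp only: B sum_constant card_lessThan)
  also have "\<dots> \<le> (\<Sum>q<Q. \<Sum>p<L. real (card (?Y (q * L + p))))"
    using Y by (intro sum_mono) auto
  also have "\<dots> = (\<Sum>q<Q. \<Sum>x\<in>{q * L..<q * L + L}. real (card (?Y x)))"
  proof (rule sum.cong[OF refl])
    fix q
    show "(\<Sum>p<L. real (card (?Y (q * L + p)))) = (\<Sum>x\<in>{q * L..<q * L + L}. real (card (?Y x)))"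
      by (rule sum.reindex_bij_witness[of _ "\<lambda>x. x - q * L" "\<lambda>p. q * L + p"]) auto
  qed
  also have "\<dots> = (\<Sum>x<Q * L. real (card (?Y x)))"
    by (rule sum.nat_group)
  also have "\<dots> = real (card (Sigma {..<Q * L} ?Y))" by (subst card_SigmaI) auto
  also have "\<dots> = real (card (?f ` Sigma {..<Q * L} ?Y))" using card_image[OF inj] by simp
  also have "\<dots> \<le> real (card (edges (block_graph n k L (m + 1))))"
    using card_mono[OF fin sub] by simp
  finally show ?thesis .
qed

section \<open>Densities\<close>

text \<open>The limiting density of the block graph with \<open>m + 1\<close> colours at the best
  block length; here \<open>m = t - 2\<close>.\<close>

definition block_density :: "nat \<Rightarrow> real" where
  "block_density m = 1 + real m - sqrt (real m ^ 2 + 1)"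

lemma block_density_eq:
  "t \<ge> 2 \<Longrightarrow> block_density (t - 2) = real t - 1 - sqrt ((real t - 2)^2 + 1)"
  by (simp add: block_density_def of_nat_diff)

text \<open>The square of \<open>m + 1 / (2 * m)\<close> exceeds \<open>m\<^sup>2 + 1\<close> by
  \<open>1 / (4 * m\<^sup>2)\<close>. Strictness later pays for the additive \<open>1\<close> in the
  average degree.\<close>

lemma block_density_gt:
  assumes "m \<ge> 1"
  shows "block_density m > 1 - 1 / (2 * real m)"
proof -
  have "sqrt (real m ^ 2 + 1) < real m + 1 / (2 * real m)"
    using assms by (intro real_less_lsqrt) (auto simp: power2_eq_square field_simps)
  then show ?thesis by (simp add: block_density_def)
qed

text \<open>Without the vanishing \<open>1 / k\<close> terms the expression is
  \<open>1 + m - ((m\<^sup>2 + 1) * l + 1 / l) / 2\<close>, which is largest at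
  \<open>l = 1 / sqrt (m\<^sup>2 + 1)\<close>.\<close>

lemma tendsto_block_density:
  fixes l :: "nat \<Rightarrow> real"
  assumes l: "l \<longlonglongrightarrow> 1 / sqrt (real m ^ 2 + 1)"
  shows "(\<lambda>k. 1 - ((l k - 1 / real k) + (1 - real m * l k) * (1 - real m * l k + 1 / real k) / l k) / 2)
    \<longlonglongrightarrow> block_density m"
proof -
  define R where "R = sqrt (real m ^ 2 + 1)"
  have R: "R > 0" "R * R = real m * real m + 1"
    unfolding R_def by (auto simp: add_nonneg_pos power2_eq_square)
  have i: "(\<lambda>k. 1 / real k) \<longlonglongrightarrow> 0" by (rule lim_1_over_n)
  have "(\<lambda>k. 1 - ((l k - 1 / real k) + (1 - real m * l k) * (1 - real m * l k + 1 / real k) / l k) / 2)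
    \<longlonglongrightarrow> 1 - ((1 / R - 0) + (1 - real m * (1 / R)) * (1 - real m * (1 / R) + 0) / (1 / R)) / 2"
    using R by (intro tendsto_intros i l[folded R_def]) auto
  also have "1 - ((1 / R - 0) + (1 - real m * (1 / R)) * (1 - real m * (1 / R) + 0) / (1 / R)) / 2
      = 1 + real m - (1 + R * R + real m * real m) / (2 * R)"
    using R(1) by (simp add: field_simps)
  also have "\<dots> = 1 + real m - R"
    using R by (simp add: field_simps)
  finally show ?thesis by (simp add: block_density_def R_def)
qed

lemma eventually_dense_free_subgraph:
  assumes m: "m \<ge> 1" and a: "a < block_density m"
  shows "\<forall>\<^sub>F k in sequentially. \<forall>\<^sub>F n in sequentially. \<exists>H. subgraph H (cycle_power n k) \<and>
    free_of (complete_graph (m + 2)) H \<and> verts H = {..<n} \<and>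
    a * (real n * real k) \<le> real (card (edges H))"
proof -
  define c where "c = 1 / sqrt (real m ^ 2 + 1)"
  define L where "L = (\<lambda>k::nat. nat \<lfloor>c * real k\<rfloor>)"
  define l where "l = (\<lambda>k. real (L k) / real k)"
  have "1 / (2 * real m) < 1" using m by simp
  then have "block_density m > 0" using block_density_gt[OF m] by linarith
  then obtain b where b: "a < b" "0 < b" "b < block_density m"
    using a dense[of "max a 0" "block_density m"] by auto
  \<comment> \<open>These bounds put the optimal ratio strictly between \<open>1 / (m + 1)\<close>
    and \<open>1 / m\<close>, as \<open>card_edges_block_graph_ge\<close> requires.\<close>
  have sq: "real m < sqrt (real m ^ 2 + 1)" "sqrt (real m ^ 2 + 1) < real m + 1"
    using m by (auto intro!: real_less_rsqrt real_less_lsqrt simp: power2_eq_square algebra_simps)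
  have c: "c > 0" "real m * c < 1" "1 / (real m + 1) < c"
    using sq m unfolding c_def by (auto simp: field_simps add_nonneg_pos)
  have lim: "l \<longlonglongrightarrow> c"
  proof (rule real_tendsto_sandwich)
    show "\<forall>\<^sub>F k in sequentially. c - 1 / real k \<le> l k"
      using eventually_gt_at_top[of 0]
    proof eventually_elim
      case (elim k)
      have "c * real k - 1 \<le> real (L k)" using c unfolding L_def by linarith
      then have "(c * real k - 1) / real k \<le> l k" unfolding l_def by (intro divide_right_mono) auto
      then show ?case using elim by (simp add: diff_divide_distrib)
    qed
    show "\<forall>\<^sub>F k in sequentially. l k \<le> c"
      using eventually_gt_at_top[of 0]
    proof eventually_elim
      case (elim k)
      have "real (L k) \<le> c * real k" using c unfolding L_def by (simp add: of_nat_nat)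
      then show ?case using elim by (simp add: l_def pos_divide_le_eq)
    qed
    show "(\<lambda>k. c - 1 / real k) \<longlonglongrightarrow> c"
      using tendsto_diff[OF tendsto_const lim_1_over_n, of c] by simp
  qed simp
  have "(\<lambda>k. real m * l k) \<longlonglongrightarrow> real m * c" by (intro tendsto_intros lim)
  then have "\<forall>\<^sub>F k in sequentially. real m * l k < 1" using c by (intro order_tendstoD)
  moreover have "\<forall>\<^sub>F k in sequentially. 1 / (real m + 1) < l k" using c lim by (intro order_tendstoD)
  moreover have "\<forall>\<^sub>F k in sequentially.
      b < 1 - ((l k - 1 / real k) + (1 - real m * l k) * (1 - real m * l k + 1 / real k) / l k) / 2"
    using tendsto_block_density[OF lim[unfolded c_def]] b by (intro order_tendstoD)
  ultimately show ?thesis using eventually_gt_at_top[of 0]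
  proof eventually_elim
    case (elim k)
    have k: "k > 0" using elim by simp
    have "l k > 0" using elim(2) by (rule less_trans[rotated]) simp
    then have Lpos: "L k > 0" using k by (simp add: l_def zero_less_divide_iff)
    have "real m * real (L k) < real k" using elim(1) k by (simp add: l_def field_simps)
    then have "real (m * L k) < real k" by simp
    then have 1: "m * L k \<le> k" by (simp only: of_nat_less_iff less_imp_le)
    have "real k < (real m + 1) * real (L k)" using elim(2) k by (simp add: l_def field_simps)
    then have "real k < real ((m + 1) * L k)" by (simp add: algebra_simps)
    then have 2: "k \<le> (m + 1) * L k" by (simp only: of_nat_less_iff less_imp_le)
    define g where "g = real (L k) * real k - (real (L k) * (real (L k) - 1)
      + (real k - real m * real (L k)) * (real k - real m * real (L k) + 1)) / 2"
    have "g = (1 - ((l k - 1 / real k) + (1 - real m * l k) * (1 - real m * l k + 1 / real k) / l k) / 2)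
       * (real (L k) * real k)"
    proof -
      define A where "A = real k - real m * real (L k)"
      have "1 - real m * l k = A / real k" "1 - real m * l k + 1 / real k = (A + 1) / real k"
        using k by (simp_all add: l_def A_def diff_divide_distrib add_divide_distrib)
      moreover have "A / real k * ((A + 1) / real k) / l k * (real (L k) * real k) = A * (A + 1)"
        using k Lpos by (simp add: l_def)
      moreover have "(l k - 1 / real k) * (real (L k) * real k) = real (L k) * (real (L k) - 1)"
        using k by (simp add: l_def field_simps)
      ultimately show ?thesis
        unfolding g_def A_def[symmetric] by (simp add: left_diff_distrib distrib_right)
    qed
    then have g: "b * (real (L k) * real k) \<le> g"
      using elim(3) by (simp add: mult_right_mono)
    \<comment> \<open>The threshold is \<open>a * n \<le> b * (n - k - L k)\<close> solved for
      \<open>n\<close>.\<close>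
    have "\<forall>\<^sub>F n in sequentially. real n \<ge> (real k + real (L k)) * b / (b - a)"
      by real_asymp
    then show ?case using eventually_ge_at_top[of k]
    proof eventually_elim
      case (elim n)
      define Q where "Q = (n - k) div L k"
      have "Q * L k \<le> n - k" unfolding Q_def by (rule div_times_less_eq_dividend)
      then have "Q * L k + k \<le> n" using elim(2) by linarith
      then have E: "real Q * g \<le> real (card (edges (block_graph n k (L k) (m + 1))))"
        using card_edges_block_graph_ge[OF Lpos 1 2] unfolding g_def by blast
      have "n - k < (Q + 1) * L k" unfolding Q_def
        using Lpos by (simp add: dividend_less_times_div add.commute mult.commute)
      then have "real (n - k) \<le> real ((Q + 1) * L k)" by (simp only: of_nat_le_iff less_imp_le)
      then have QL: "real n - real k - real (L k) \<le> real Q * real (L k)"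
        using elim(2) by (simp add: of_nat_diff algebra_simps)
      have "(real k + real (L k)) * b \<le> real n * (b - a)"
        using elim(1) b(1) by (simp add: field_simps)
      then have "a * real n \<le> b * (real n - real k - real (L k))" by (simp add: algebra_simps)
      also have "\<dots> \<le> b * (real Q * real (L k))" using QL b(2) by (intro mult_left_mono) auto
      finally have "a * real n * real k \<le> b * (real Q * real (L k)) * real k"
        by (rule mult_right_mono) simp
      also have "\<dots> = real Q * (b * (real (L k) * real k))" by simp
      also have "\<dots> \<le> real Q * g" using g by (rule mult_left_mono) simp
      finally have "a * (real n * real k) \<le> real (card (edges (block_graph n k (L k) (m + 1))))"
        using E by simp
      then show ?case
        using subgraph_block_graph block_graph_free[of "m + 1"]
        by (intro exI[of _ "block_graph n k (L k) (m + 1)"]) (auto simp: numeral_2_eq_2)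
    qed
  qed
qed

section \<open>Extremal numbers and their limits superior\<close>

lemma finite_extremal_set:
  assumes "finite (edges G)"
  shows "finite {card (edges H) | H. subgraph H G \<and> free_of F H}"
  by (rule finite_subset[of _ "{..card (edges G)}"])
     (use assms in \<open>auto simp: subgraph_def intro!: card_mono\<close>)

lemma finite_edges_cycle_power: "finite (edges (cycle_power n k))"
  by (rule finite_edges_subgraph[of _ "cycle_power n k"])
     (use simple_graph_cycle_power in \<open>auto simp: subgraph_def\<close>)

lemma card_edges_le_extremal_number:
  assumes "subgraph H (cycle_power n k)" "free_of F H"
  shows "card (edges H) \<le> extremal_number (cycle_power n k) F"
  unfolding extremal_number_def
  using assms finite_extremal_set[OF finite_edges_cycle_power] by (intro Max_ge) auto

lemma extremal_number_triangle_le: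
  "real (extremal_number (cycle_power n k) (complete_graph 3)) \<le> (3 / 5 * real k + 223) * real n"
proof -
  let ?S = "{card (edges H) | H. subgraph H (cycle_power n k) \<and> free_of (complete_graph 3) H}"
  \<comment> \<open>The empty graph makes the set nonempty, so that its \<open>Max\<close> is
    attained.\<close>
  have "subgraph (Graph {} {}) (cycle_power n k)" "free_of (complete_graph 3) (Graph {} {})"
    by (auto simp: subgraph_def simple_graph_def contains_copy_def complete_graph_def lessThan_nat_numeral)
  then have "?S \<noteq> {}" by blast
  then have "Max ?S \<in> ?S" by (intro Max_in finite_extremal_set finite_edges_cycle_power)
  then show ?thesis
    unfolding extremal_number_def[symmetric] using card_edges_triangle_free_le by fastforce
qed

lemma block_density_le_pi_cyc:
  assumes "m \<ge> 1"
  shows "ereal (block_density m) \<le> pi_cyc (complete_graph (m + 2))"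
proof (rule dense_le)
  fix x assume x: "x < ereal (block_density m)"
  show "x \<le> pi_cyc (complete_graph (m + 2))"
  proof (cases x)
    case (real a)
    then have a: "a < block_density m" using x by simp
    show ?thesis unfolding pi_cyc_def real
    proof (rule le_Limsup)
      show "\<forall>\<^sub>F k in sequentially. ereal a \<le> limsup (\<lambda>n.
        ereal (real (extremal_number (cycle_power n k) (complete_graph (m + 2))) /
          real (card (edges (cycle_power n k)))))"
        using eventually_dense_free_subgraph[OF assms a] eventually_gt_at_top[of 0]
      proof eventually_elim
        case (elim k)
        show ?case
        proof (rule le_Limsup)
          show "\<forall>\<^sub>F n in sequentially. ereal a
            \<le> ereal (real (extremal_number (cycle_power n k) (complete_graph (m + 2))) /
                real (card (edges (cycle_power n k))))"
            using elim(1) eventually_gt_at_top[of "2 * k"]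
          proof eventually_elim
            case (elim n)
            then obtain H where H: "subgraph H (cycle_power n k)" "free_of (complete_graph (m + 2)) H"
              "a * (real n * real k) \<le> real (card (edges H))" by blast
            have "a * (real n * real k) \<le> real (extremal_number (cycle_power n k) (complete_graph (m + 2)))"
              using H(3) card_edges_le_extremal_number[OF H(1,2)] by linarith
            moreover have "real n * real k > 0" using elim \<open>0 < k\<close> by simp
            ultimately show ?case using card_edges_cycle_power[OF elim(2)] by (simp add: field_simps)
          qed
        qed simp
      qed
    qed simp
  qed (use x in auto)
qed

text \<open>For \<open>n > 2 * k\<close> there are \<open>n * k\<close> edges, so the additive error
  \<open>223 * n\<close> costs only \<open>223 / k\<close>, which vanishes.\<close>

lemma pi_cyc_triangle_le: "pi_cyc (complete_graph 3) \<le> ereal (3 / 5)"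
proof -
  have "limsup (\<lambda>n. ereal (real (extremal_number (cycle_power n k) (complete_graph 3)) /
      real (card (edges (cycle_power n k))))) \<le> ereal (3 / 5 + 223 / real k)" if k: "k > 0" for k
  proof (rule Limsup_bounded)
    show "\<forall>\<^sub>F n in sequentially. ereal (real (extremal_number (cycle_power n k) (complete_graph 3)) /
      real (card (edges (cycle_power n k)))) \<le> ereal (3 / 5 + 223 / real k)"
      using eventually_gt_at_top[of "2 * k"]
    proof eventually_elim
      case (elim n)
      then have "real n > 0" by simp
      then show ?case
        using extremal_number_triangle_le[of n k] k card_edges_cycle_power[OF elim]
        by (simp add: field_simps)
    qed
  qed
  then have "pi_cyc (complete_graph 3) \<le> limsup (\<lambda>k. ereal (3 / 5 + 223 / real k))"
    unfolding pi_cyc_def by (intro Limsup_mono eventually_mono[OF eventually_gt_at_top[of 0]])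
  also have "\<dots> = ereal (3 / 5)"
    by (intro lim_imp_Limsup) (simp, simp only: lim_ereal, real_asymp)
  finally show ?thesis .
qed

lemma average_degree_eq:
  assumes "simple_graph H"
  shows "average_degree H = 2 * real (card (edges H)) / real (card (verts H))"
proof -
  have V: "finite (verts H)" using assms by (simp add: simple_graph_def)
  have E: "finite (edges H)"
    using assms finite_subset[of "edges H" "Pow (verts H)"] by (auto simp: simple_graph_def)
  have "(\<Sum>v\<in>verts H. real (degree H v)) = (\<Sum>v\<in>verts H. \<Sum>e\<in>edges H. of_bool (v \<in> e))"
    using E by (simp add: degree_def Int_def)
  also have "\<dots> = (\<Sum>e\<in>edges H. \<Sum>v\<in>verts H. of_bool (v \<in> e))" by (rule sum.swap)
  also have "\<dots> = (\<Sum>e\<in>edges H. 2)"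
  proof (rule sum.cong[OF refl])
    fix e assume "e \<in> edges H"
    then have "verts H \<inter> {v. v \<in> e} = e" "card e = 2" using assms by (auto simp: simple_graph_def)
    then show "(\<Sum>v\<in>verts H. of_bool (v \<in> e)) = (2::real)" using V by simp
  qed
  finally show ?thesis by (simp add: average_degree_def)
qed

text \<open>A density \<open>a\<close> above \<open>1 - 1 / (2 * m)\<close> leaves a surplus
  \<open>d * k\<close> that eventually exceeds the additive \<open>1\<close>. The subgraph has all
  \<open>n\<close> vertices, so its average degree is at least \<open>2 * a * k\<close>.\<close>

lemma eventually_average_degree:
  assumes m: "m \<ge> 1"
  shows "\<forall>\<^sub>F k in sequentially. \<forall>\<^sub>F n in sequentially. \<exists>H. subgraph H (cycle_power n k) \<and>
    free_of (complete_graph (m + 2)) H \<and> average_degree H > (2 - 1 / real m) * real k + 1"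
proof -
  obtain a where a: "1 - 1 / (2 * real m) < a" "a < block_density m"
    using dense[OF block_density_gt[OF m]] by blast
  define d where "d = 2 * a - (2 - 1 / real m)"
  have "d > 0" using a(1) m by (simp add: d_def field_simps)
  then have "\<forall>\<^sub>F k in sequentially. 1 < d * real k" by real_asymp
  then show ?thesis using eventually_dense_free_subgraph[OF m a(2)]
  proof eventually_elim
    case (elim k)
    have ak: "(2 - 1 / real m) * real k + 1 < 2 * (a * real k)"
      using elim(1) by (simp add: d_def algebra_simps)
    show ?case using elim(2) eventually_gt_at_top[of 0]
    proof eventually_elim
      case (elim n)
      then obtain H where H: "subgraph H (cycle_power n k)" "free_of (complete_graph (m + 2)) H"
        "verts H = {..<n}" "a * (real n * real k) \<le> real (card (edges H))" by blast
      have "average_degree H = 2 * real (card (edges H)) / real n"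
        using H average_degree_eq[of H] by (simp add: subgraph_def)
      moreover have "2 * (a * real k) * real n \<le> 2 * real (card (edges H))"
        using H(4) by (simp add: algebra_simps)
      ultimately have "2 * (a * real k) \<le> average_degree H"
        using elim(2) by (simp add: pos_le_divide_eq)
      then show ?case using H ak by (intro exI[of _ H]) auto
    qed
  qed
qed

text \<open>\<open>r\<close> is the exact remainder of the expansion. Its sign comes from squaring
  the truncated expansion of the square root, which gives at most
  \<open>x\<^sup>2 + 1\<close>.\<close>

lemma sqrt_expansion:
  fixes r :: "nat \<Rightarrow> real"
  defines "r \<equiv> \<lambda>t. 1 - 1 / (2 * (real t - 2)) + 1 / (8 * (real t - 2)^3)
      - (real t - 1 - sqrt ((real t - 2)^2 + 1))"
  shows "r \<in> O(\<lambda>t. 1 / (real t - 2)^5)" and "t \<ge> 3 \<Longrightarrow> r t \<ge> 0"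
proof -
  show "r \<in> O(\<lambda>t. 1 / (real t - 2)^5)" unfolding r_def by real_asymp
  assume "t \<ge> 3"
  define x where "x = real t - 2"
  have x: "x \<ge> 1" using \<open>t \<ge> 3\<close> by (simp add: x_def)
  have x4: "x ^ 4 \<ge> 1" using x by (rule one_le_power)
  have "(x + 1 / (2 * x) - 1 / (8 * x ^ 3))\<^sup>2 = x\<^sup>2 + 1 - 1 / (8 * x ^ 4) + 1 / (64 * x ^ 6)"
    using x by (simp add: field_simps power2_eq_square) (simp add: algebra_simps eval_nat_numeral)
  also have "\<dots> \<le> x\<^sup>2 + 1"
  proof -
    have "x ^ 4 \<le> x ^ 6" using x by (intro power_increasing) auto
    then have "1 / (64 * x ^ 6) \<le> 1 / (8 * x ^ 4)" using x4 by (intro divide_left_mono) auto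
    then show ?thesis by simp
  qed
  finally have "x + 1 / (2 * x) - 1 / (8 * x ^ 3) \<le> sqrt (x\<^sup>2 + 1)" by (rule real_le_rsqrt)
  then show "r t \<ge> 0" by (simp add: r_def x_def)
qed

theorem proposition1p7:
  shows "ereal (2 - sqrt 2) \<le> pi_cyc (complete_graph 3) \<and> pi_cyc (complete_graph 3) \<le> ereal (3 / 5)
    \<and> (\<forall>t::nat. t \<ge> 3 \<longrightarrow>
         ereal (real t - 1 - sqrt ((real t - 2)^2 + 1)) \<le> pi_cyc (complete_graph t))
    \<and> (\<exists>r :: nat \<Rightarrow> real. r \<in> O(\<lambda>t. 1 / (real t - 2)^5) \<and>
         (\<forall>t::nat. t \<ge> 3 \<longrightarrow> r t \<ge> 0 \<and>
            real t - 1 - sqrt ((real t - 2)^2 + 1)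
              = 1 - 1 / (2 * (real t - 2)) + 1 / (8 * (real t - 2)^3) - r t))
    \<and> (\<forall>t::nat. t \<ge> 3 \<longrightarrow>
         (\<forall>\<^sub>F k in sequentially. \<forall>\<^sub>F n in sequentially.
            (\<exists>H. subgraph H (cycle_power n k) \<and> free_of (complete_graph t) H \<and>
                 average_degree H > (2 - 1 / (real t - 2)) * real k + 1) \<and>
            (\<forall>H. subgraph H (cycle_power n k) \<and> verts H \<noteq> {} \<and>
                 real (minimum_degree H) > (2 - 1 / (real t - 2)) * real k + 1 \<longrightarrow>
                 contains_copy (complete_graph t) H)))"
proof (intro conjI allI impI)
  have lower: "ereal (real t - 1 - sqrt ((real t - 2)^2 + 1)) \<le> pi_cyc (complete_graph t)"
    if "t \<ge> 3" for t :: nat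
  proof -
    have t: "1 \<le> t - 2" "2 \<le> t" "t - 2 + 2 = t" using that by auto
    show ?thesis using block_density_le_pi_cyc[OF t(1)] unfolding t(3) block_density_eq[OF t(2)] .
  qed
  then show "ereal (real t - 1 - sqrt ((real t - 2)^2 + 1)) \<le> pi_cyc (complete_graph t)"
    if "t \<ge> 3" for t :: nat using that .
  show "ereal (2 - sqrt 2) \<le> pi_cyc (complete_graph 3)" using lower[of 3] by simp
  show "pi_cyc (complete_graph 3) \<le> ereal (3 / 5)" by (rule pi_cyc_triangle_le)
  show "\<exists>r :: nat \<Rightarrow> real. r \<in> O(\<lambda>t. 1 / (real t - 2)^5) \<and>
         (\<forall>t::nat. t \<ge> 3 \<longrightarrow> r t \<ge> 0 \<and>
            real t - 1 - sqrt ((real t - 2)^2 + 1)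
              = 1 - 1 / (2 * (real t - 2)) + 1 / (8 * (real t - 2)^3) - r t)"
    using sqrt_expansion
    by (intro exI[of _ "\<lambda>t. 1 - 1 / (2 * (real t - 2)) + 1 / (8 * (real t - 2)^3)
      - (real t - 1 - sqrt ((real t - 2)^2 + 1))"]) auto
next
  fix t :: nat assume t: "t \<ge> 3"
  then have m: "real t - 2 = real (t - 2)" "t - 2 + 2 = t" "1 \<le> t - 2" by auto
  show "\<forall>\<^sub>F k in sequentially. \<forall>\<^sub>F n in sequentially.
            (\<exists>H. subgraph H (cycle_power n k) \<and> free_of (complete_graph t) H \<and>
                 average_degree H > (2 - 1 / (real t - 2)) * real k + 1) \<and>
            (\<forall>H. subgraph H (cycle_power n k) \<and> verts H \<noteq> {} \<and>
                 real (minimum_degree H) > (2 - 1 / (real t - 2)) * real k + 1 \<longrightarrow>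
                 contains_copy (complete_graph t) H)"
    using eventually_average_degree[OF m(3)] contains_complete_graph_if_minimum_degree[OF _ _ m(3)]
    unfolding m(1,2) by (auto elim!: eventually_mono)
qed

end
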